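(* Let $m\ge 2$, $q>1$, $T_1>0$, $T_j>(q-1)T_1$ for $j=2,\dots,m$, $y_0\in\mathbb{R}$, $a_j,b_j,c_j\in\mathbb{R}$ and $\alpha_j>0$ for $j=1,\dots,m$. A function $y\in W_2^1(\Gamma_m)$ is a solution of the variational problem $\mathcal{V}$ if and only if $y$ is a generalized solution of the boundary value problem $\mathcal{B}$.
   Context: Function spaces. All functions are real-valued. $W_2^k[a,b]$ is the Sobolev space of functions on $[a,b]$ with (weak) derivatives up to order $k$ in $L_2(a,b)$; for $k\ge1$ its elements are identified with their continuous representatives. A function on the star graph $\Gamma_m$ is a tuple $y=[y_1,\dots,y_m]$ with $y_j$ defined on $[0,T_j]$. $W_2^k(\Gamma_m)=\bigoplus_{j=1}^m W_2^k[0,T_j]$ with $(y,z)_{W_2^k(\Gamma_m)}=\sum_{j=1}^m (y_j,z_j)_{W_2^k[0,T_j]}$, where $(f,g)_{W_2^k[a,b]}=\sum_{\nu=0}^k (f^{(\nu)},g^{(\nu)})_{L_2(a,b)}$. Set $l_1:=T_1$ and $l_j:=q^{-1}(T_j-(q-1)T_1)$ for $j=2,\dots,m$. Global delay convention: for any function $y$ on $\Gamma_m$, the components with $j=2,\dots,m$ are always extended to negative arguments by $y_j(t)=y_1(t+T_1)$ for $(q^{-1}-1)T_1<t<0$ (and likewise for derivatives). Expressions: $\ell_1y(t)=y_1'(t)+a_1y_1'(q^{-1}t)+b_1y_1(t)+c_1y_1(q^{-1}t)$ for $0<t<T_1$, and $\ell_jy(t)=y_j'(t)+a_jy_j'(q^{-1}(t-(q-1)T_1))+b_jy_j(t)+c_jy_j(q^{-1}(t-(q-1)T_1))$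 for $0<t<T_j$, $j=2,\dots,m$. Conditions: (I) $y_1(0)=y_0$; (C) $y_j(0)=y_1(T_1)$, $j=2,\dots,m$; (E) $y_j(t)=0$ for $l_j\le t\le T_j$, $j=2,\dots,m$. Variational problem $\mathcal{V}$: minimize $\mathcal{J}(y)=\sum_{j=1}^m\alpha_j\int_0^{T_j}(\ell_jy(t))^2\,dt$ over all $y\in W_2^1(\Gamma_m)$ satisfying (I), (C), (E) (with the global delay convention). A solution of $\mathcal{V}$ is a $y\in W_2^1(\Gamma_m)$ satisfying (I), (C), (E) at which this minimum is attained. Boundary value problem $\mathcal{B}$. For $\nu\in\{0,1\}$ put $\theta_{1,j}=a_j$, $\theta_{0,j}=c_j$, $j=1,\dots,m$, and $\widetilde\ell_{\nu,1}y(t)=q\alpha_1\theta_{\nu,1}\,\ell_1y(qt)$ for $0<t<q^{-1}T_1$, $\widetilde\ell_{\nu,1}y(t)=q\sum_{k=2}^m\alpha_k\theta_{\nu,k}\,\ell_ky(qt-T_1)$ for $q^{-1}T_1<t<T_1$; for $j=2,\dots,m$: $\widetilde\ell_{\nu,j}y(t)=q\alpha_j\theta_{\nu,j}\,\ell_jy(qt+(q-1)T_1)$ for $0<t<l_j$, $\widetilde\ell_{\nu,j}y(t)=0$ for $l_j<t<T_j$. Let $\widehat\ell_jy(t):=\alpha_j\ell_jy(t)+\widetilde\ell_{1,j}y(t)$, $j=1,\dots,m$. Problem $\mathcal{B}$ consists of the equations $$\mathcal{L}_jy(t):=-\big(\widehat\ell_jy(t)\big)'+\alpha_jb_j\ell_jy(t)+\widetilde\ell_{0,j}y(t)=0,\quad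 0<t<l_j,\quad j=1,\dots,m,$$ together with (I), (C), (E), the global delay convention, and the Kirchhoff-type condition $$\widehat\ell_1y(T_1)=\sum_{j=2}^m\widehat\ell_jy(0).$$ A generalized solution of $\mathcal{B}$ is a function $y=[y_1,\dots,y_m]\in W_2^1(\Gamma_m)$ such that $\widehat\ell_jy\in W_2^1[0,l_j]$ for $j=1,\dots,m$ and all the equations (almost everywhere) and conditions of $\mathcal{B}$ hold. *)

theory Defs
  imports "HOL-Analysis.Analysis"
begin

text \<open>
  Elements of \<open>L\<^sub>2(a,b)\<close> and \<open>W\<^sub>2\<^sup>1[a,b]\<close> are represented by functions on the whole real line, of
  which only the values on the interval matter. Classes modulo null sets are represented by
  Borel functions (every class contains one).
\<close>

definition L2_on :: "real \<Rightarrow> real \<Rightarrow> (real \<Rightarrow> real) set" where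
  "L2_on a b = {f. set_borel_measurable lborel {a<..<b} f \<and>
                   set_integrable lborel {a<..<b} (\<lambda>t. (f t)\<^sup>2)}"

text \<open>
  Weak derivatives are tested, as in Brezis, Functional Analysis, Sobolev Spaces and PDE, Sect. 8.2,
  against \<open>C\<^sup>1\<close> functions with compact support in the open interval.
  Smooth test functions give the same notion, by mollification.
\<close>

definition test_function :: "real \<Rightarrow> real \<Rightarrow> (real \<Rightarrow> real) \<Rightarrow> bool" where
  "test_function a b \<phi> \<longleftrightarrow>
     (\<forall>t. \<phi> differentiable (at t)) \<and> continuous_on UNIV (deriv \<phi>) \<and>
     (\<exists>K. compact K \<and> K \<subseteq> {a<..<b} \<and> (\<forall>t. t \<notin> K \<longrightarrow> \<phi> t = 0))"

definition is_weak_deriv :: "real \<Rightarrow> real \<Rightarrow> (real \<Rightarrow> real) \<Rightarrow> (real \<Rightarrow> real) \<Rightarrow> bool" where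
  "is_weak_deriv a b f g \<longleftrightarrow>
     (\<forall>\<phi>. test_function a b \<phi> \<longrightarrow>
        (LINT t:{a<..<b}|lborel. f t * deriv \<phi> t) = - (LINT t:{a<..<b}|lborel. g t * \<phi> t))"

definition W21_class :: "real \<Rightarrow> real \<Rightarrow> (real \<Rightarrow> real) set" where
  "W21_class a b = {f \<in> L2_on a b. \<exists>g \<in> L2_on a b. is_weak_deriv a b f g}"

text \<open>
  \<open>W21_class\<close> contains all representatives of the elements of \<open>W\<^sub>2\<^sup>1[a,b]\<close>, \<open>W21\<close> only the
  continuous ones. The functions \<open>weak_deriv a b f\<close> and (on \<open>[a,b]\<close>) \<open>cont_rep a b f\<close> depend only
  on the class of \<open>f\<close>, the former up to a null set.
\<close>

definition W21 :: "real \<Rightarrow> real \<Rightarrow> (real \<Rightarrow> real) set" where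
  "W21 a b = {f \<in> W21_class a b. continuous_on {a..b} f}"

definition weak_deriv :: "real \<Rightarrow> real \<Rightarrow> (real \<Rightarrow> real) \<Rightarrow> real \<Rightarrow> real" where
  "weak_deriv a b f = (SOME g. g \<in> L2_on a b \<and> is_weak_deriv a b f g)"

definition cont_rep :: "real \<Rightarrow> real \<Rightarrow> (real \<Rightarrow> real) \<Rightarrow> real \<Rightarrow> real" where
  "cont_rep a b f =
     (SOME h. continuous_on {a..b} h \<and> (AE t\<in>{a<..<b} in lborel. h t = f t))"

text \<open>
  A function on the star graph is \<open>y :: nat \<Rightarrow> real \<Rightarrow> real\<close>, where only \<open>y j t\<close> with
  \<open>j \<in> {1..m}\<close> and \<open>t \<in> {0..T j}\<close> matters.
\<close>

definition W21_graph :: "nat \<Rightarrow> (nat \<Rightarrow> real) \<Rightarrow> (nat \<Rightarrow> real \<Rightarrow> real) set" where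
  "W21_graph m T = {y. \<forall>j\<in>{1..m}. y j \<in> W21 0 (T j)}"

definition graph_deriv :: "(nat \<Rightarrow> real) \<Rightarrow> (nat \<Rightarrow> real \<Rightarrow> real) \<Rightarrow> nat \<Rightarrow> real \<Rightarrow> real" where
  "graph_deriv T y j = weak_deriv 0 (T j) (y j)"

definition delay_ext :: "(nat \<Rightarrow> real) \<Rightarrow> (nat \<Rightarrow> real \<Rightarrow> real) \<Rightarrow> nat \<Rightarrow> real \<Rightarrow> real" where
  "delay_ext T y j t = (if j \<noteq> 1 \<and> t < 0 then y 1 (t + T 1) else y j t)"

definition len :: "real \<Rightarrow> (nat \<Rightarrow> real) \<Rightarrow> nat \<Rightarrow> real" where
  "len q T j = (if j = 1 then T 1 else (T j - (q - 1) * T 1) / q)"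

definition ell ::
  "real \<Rightarrow> (nat \<Rightarrow> real) \<Rightarrow> (nat \<Rightarrow> real) \<Rightarrow> (nat \<Rightarrow> real) \<Rightarrow> (nat \<Rightarrow> real) \<Rightarrow>
   (nat \<Rightarrow> real \<Rightarrow> real) \<Rightarrow> nat \<Rightarrow> real \<Rightarrow> real" where
  "ell q T a b c y j t =
     (let s = (if j = 1 then t / q else (t - (q - 1) * T 1) / q) in
      graph_deriv T y j t + a j * delay_ext T (graph_deriv T y) j s
      + b j * y j t + c j * delay_ext T y j s)"

definition admissible ::
  "nat \<Rightarrow> real \<Rightarrow> (nat \<Rightarrow> real) \<Rightarrow> real \<Rightarrow> (nat \<Rightarrow> real \<Rightarrow> real) \<Rightarrow> bool" where
  "admissible m q T y0 y \<longleftrightarrow>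
     y 1 0 = y0 \<and>
     (\<forall>j\<in>{2..m}. y j 0 = y 1 (T 1)) \<and>
     (\<forall>j\<in>{2..m}. \<forall>t\<in>{len q T j..T j}. y j t = 0)"

definition cost ::
  "nat \<Rightarrow> real \<Rightarrow> (nat \<Rightarrow> real) \<Rightarrow> (nat \<Rightarrow> real) \<Rightarrow> (nat \<Rightarrow> real) \<Rightarrow> (nat \<Rightarrow> real) \<Rightarrow> (nat \<Rightarrow> real) \<Rightarrow>
   (nat \<Rightarrow> real \<Rightarrow> real) \<Rightarrow> real" where
  "cost m q T \<alpha> a b c y =
     (\<Sum>j=1..m. \<alpha> j * (LINT t:{0<..<T j}|lborel. (ell q T a b c y j t)\<^sup>2))"

definition variational_solution ::
  "nat \<Rightarrow> real \<Rightarrow> (nat \<Rightarrow> real) \<Rightarrow> (nat \<Rightarrow> real) \<Rightarrow> (nat \<Rightarrow> real) \<Rightarrow> (nat \<Rightarrow> real) \<Rightarrow> (nat \<Rightarrow> real) \<Rightarrow>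
   real \<Rightarrow> (nat \<Rightarrow> real \<Rightarrow> real) \<Rightarrow> bool" where
  "variational_solution m q T \<alpha> a b c y0 y \<longleftrightarrow>
     y \<in> W21_graph m T \<and> admissible m q T y0 y \<and>
     (\<forall>z \<in> W21_graph m T. admissible m q T y0 z \<longrightarrow>
        cost m q T \<alpha> a b c y \<le> cost m q T \<alpha> a b c z)"

text \<open>
  \<open>ell_tilde\<close> takes the coefficients \<open>\<theta>\<^sub>\<nu>\<close> as an argument: \<open>\<theta>\<^sub>1 = a\<close> and \<open>\<theta>\<^sub>0 = c\<close>.
\<close>

definition ell_tilde ::
  "nat \<Rightarrow> real \<Rightarrow> (nat \<Rightarrow> real) \<Rightarrow> (nat \<Rightarrow> real) \<Rightarrow> (nat \<Rightarrow> real) \<Rightarrow> (nat \<Rightarrow> real) \<Rightarrow> (nat \<Rightarrow> real) \<Rightarrow>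
   (nat \<Rightarrow> real) \<Rightarrow> (nat \<Rightarrow> real \<Rightarrow> real) \<Rightarrow> nat \<Rightarrow> real \<Rightarrow> real" where
  "ell_tilde m q T \<alpha> a b c \<theta> y j t =
     (if j = 1 then
        (if t < T 1 / q then q * \<alpha> 1 * \<theta> 1 * ell q T a b c y 1 (q * t)
         else q * (\<Sum>k=2..m. \<alpha> k * \<theta> k * ell q T a b c y k (q * t - T 1)))
      else
        (if t < len q T j then q * \<alpha> j * \<theta> j * ell q T a b c y j (q * t + (q - 1) * T 1)
         else 0))"

definition ell_hat ::
  "nat \<Rightarrow> real \<Rightarrow> (nat \<Rightarrow> real) \<Rightarrow> (nat \<Rightarrow> real) \<Rightarrow> (nat \<Rightarrow> real) \<Rightarrow> (nat \<Rightarrow> real) \<Rightarrow> (nat \<Rightarrow> real) \<Rightarrow>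
   (nat \<Rightarrow> real \<Rightarrow> real) \<Rightarrow> nat \<Rightarrow> real \<Rightarrow> real" where
  "ell_hat m q T \<alpha> a b c y j t =
     \<alpha> j * ell q T a b c y j t + ell_tilde m q T \<alpha> a b c a y j t"

definition bvp_operator ::
  "nat \<Rightarrow> real \<Rightarrow> (nat \<Rightarrow> real) \<Rightarrow> (nat \<Rightarrow> real) \<Rightarrow> (nat \<Rightarrow> real) \<Rightarrow> (nat \<Rightarrow> real) \<Rightarrow> (nat \<Rightarrow> real) \<Rightarrow>
   (nat \<Rightarrow> real \<Rightarrow> real) \<Rightarrow> nat \<Rightarrow> real \<Rightarrow> real" where
  "bvp_operator m q T \<alpha> a b c y j t =
     - weak_deriv 0 (len q T j) (ell_hat m q T \<alpha> a b c y j) t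
     + \<alpha> j * b j * ell q T a b c y j t + ell_tilde m q T \<alpha> a b c c y j t"

definition kirchhoff ::
  "nat \<Rightarrow> real \<Rightarrow> (nat \<Rightarrow> real) \<Rightarrow> (nat \<Rightarrow> real) \<Rightarrow> (nat \<Rightarrow> real) \<Rightarrow> (nat \<Rightarrow> real) \<Rightarrow> (nat \<Rightarrow> real) \<Rightarrow>
   (nat \<Rightarrow> real \<Rightarrow> real) \<Rightarrow> bool" where
  "kirchhoff m q T \<alpha> a b c y \<longleftrightarrow>
     cont_rep 0 (len q T 1) (ell_hat m q T \<alpha> a b c y 1) (T 1) =
     (\<Sum>j=2..m. cont_rep 0 (len q T j) (ell_hat m q T \<alpha> a b c y j) 0)"

definition generalized_solution ::
  "nat \<Rightarrow> real \<Rightarrow> (nat \<Rightarrow> real) \<Rightarrow> (nat \<Rightarrow> real) \<Rightarrow> (nat \<Rightarrow> real) \<Rightarrow> (nat \<Rightarrow> real) \<Rightarrow> (nat \<Rightarrow> real) \<Rightarrow>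
   real \<Rightarrow> (nat \<Rightarrow> real \<Rightarrow> real) \<Rightarrow> bool" where
  "generalized_solution m q T \<alpha> a b c y0 y \<longleftrightarrow>
     y \<in> W21_graph m T \<and> admissible m q T y0 y \<and>
     (\<forall>j\<in>{1..m}. ell_hat m q T \<alpha> a b c y j \<in> W21_class 0 (len q T j)) \<and>
     (\<forall>j\<in>{1..m}. AE t\<in>{0<..<len q T j} in lborel. bvp_operator m q T \<alpha> a b c y j t = 0) \<and>
     kirchhoff m q T \<alpha> a b c y"

end

(* The cost is a quadratic functional, so its minimisers over the affine space of admissible
   functions are the y whose first variation vanishes in all admissible directions h.
   Substituting t = q s in the delayed terms of the first variation, and moving the part that falls
   on the first edge back there, turns it into the sum over j of the integrals over (0, l_j) of
   p_j h_j' + r_j h_j, where p_j is ell_hat_j and r_j collects the zeroth-order terms. Bumps on a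
   single edge show that p_j' = r_j in the weak sense; integration by parts then leaves the
   boundary term (p_1(T_1) - sum of p_j(0)) h_1(T_1), whose coefficient is the Kirchhoff defect. *)
theory Submission
  imports Defs
begin

text \<open>Two obstacles shape the proof. First, the flux p_j is known beforehand only to be square
  integrable; its weak differentiability is part of the claim, so the equation cannot be derived by
  integrating by parts. Bumps yield regularity and equation together, because for them a vanishing
  first variation is exactly the definition of a weak derivative. Only then does p_j have end-point
  values, those of its continuous representative. Second, weak derivatives are fixed only up to null
  sets, whereas (I), (C), (E) and the Kirchhoff condition concern single points.
  \<open>is_primitive\<close> reconciles the two: it keeps an explicit derivative beside a function
  that is its integral at every point of a closed interval. The length l_j arises twice: (E) kills
  h_j and h_j' beyond l_j, and for j >= 2 the delayed argument on edge j ends at l_j. The factor q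
  in \<open>ell_tilde\<close> is the Jacobian of the substitution. Positivity of the \<alpha>_j
  makes the quadratic part of the cost nonnegative, so that stationarity suffices for a
  minimum.\<close>

abbreviation intg :: "real \<Rightarrow> real \<Rightarrow> (real \<Rightarrow> real) \<Rightarrow> real" where
  "intg a b f \<equiv> (LINT t:{a<..<b}|lborel. f t)"

abbreviation intgbl :: "real \<Rightarrow> real \<Rightarrow> (real \<Rightarrow> real) \<Rightarrow> bool" where
  "intgbl a b f \<equiv> set_integrable lborel {a<..<b} f"

subsection \<open>Square-integrable functions on an interval\<close>

lemma L2_on_borel: "f \<in> L2_on a b \<Longrightarrow> set_borel_measurable lborel {a<..<b} f"
  by (simp add: L2_on_def)

lemma L2_on_mult_integrable:
  assumes "f \<in> L2_on a b" "g \<in> L2_on a b"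
  shows "intgbl a b (\<lambda>t. f t * g t)"
proof (rule set_integrable_bound)
  show "intgbl a b (\<lambda>t. (f t)\<^sup>2 + (g t)\<^sup>2)"
    using assms by (auto simp: L2_on_def)
  \<comment> \<open>Measurability is given only for the truncations to the interval; the indicator
    is idempotent, so the product of the truncations is the truncation of the product.\<close>
  have "(\<lambda>t. (indicat_real {a<..<b} t *\<^sub>R f t) * (indicat_real {a<..<b} t *\<^sub>R g t)) \<in> borel_measurable lborel"
    using assms[THEN L2_on_borel] unfolding set_borel_measurable_def
    by (intro borel_measurable_times) auto
  also have "(\<lambda>t. (indicat_real {a<..<b} t *\<^sub>R f t) * (indicat_real {a<..<b} t *\<^sub>R g t))
      = (\<lambda>t. indicat_real {a<..<b} t *\<^sub>R (f t * g t))"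
    by (auto simp: indicator_def)
  finally show "set_borel_measurable lborel {a<..<b} (\<lambda>t. f t * g t)"
    by (simp add: set_borel_measurable_def)
  have "\<bar>x * y\<bar> \<le> x\<^sup>2 + y\<^sup>2" for x y :: real
  proof -
    have "0 \<le> (\<bar>x\<bar> - \<bar>y\<bar>)\<^sup>2" "0 \<le> \<bar>x\<bar> * \<bar>y\<bar>" by auto
    then show ?thesis unfolding power2_diff abs_mult power2_abs by linarith
  qed
  then show "AE x in lborel. x \<in> {a<..<b} \<longrightarrow> norm (f x * g x) \<le> norm ((f x)\<^sup>2 + (g x)\<^sup>2)"
    by (auto simp: sum_power2_ge_zero)
qed

lemma L2_on_add:
  assumes "f \<in> L2_on a b" "g \<in> L2_on a b"
  shows "(\<lambda>t. f t + g t) \<in> L2_on a b"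
proof -
  have "intgbl a b (\<lambda>t. (f t)\<^sup>2 + (g t)\<^sup>2 + 2 * (f t * g t))"
    using assms L2_on_mult_integrable[OF assms]
    by (auto simp: L2_on_def)
  moreover have "set_borel_measurable lborel {a<..<b} (\<lambda>t. f t + g t)"
    using assms[THEN L2_on_borel]
    by (simp add: set_borel_measurable_def distrib_left)
  ultimately show ?thesis
    by (simp add: L2_on_def power2_sum algebra_simps)
qed

lemma L2_on_cmult:
  assumes "f \<in> L2_on a b"
  shows "(\<lambda>t. r * f t) \<in> L2_on a b"
proof -
  have "set_borel_measurable lborel {a<..<b} (\<lambda>t. r * f t)"
    using L2_on_borel[OF assms] borel_measurable_times[of "\<lambda>_. r" lborel "\<lambda>t. indicat_real {a<..<b} t * f t"]
    by (simp add: set_borel_measurable_def mult.left_commute)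
  then show ?thesis using assms by (simp add: L2_on_def power_mult_distrib)
qed

lemma L2_on_zero: "(\<lambda>_. 0) \<in> L2_on a b"
  by (simp add: L2_on_def set_borel_measurable_def set_integrable_def)

lemma L2_on_sum:
  assumes "finite S" "\<And>i. i \<in> S \<Longrightarrow> f i \<in> L2_on a b"
  shows "(\<lambda>t. \<Sum>i\<in>S. f i t) \<in> L2_on a b"
  using assms by (induction rule: finite_induct) (auto simp: L2_on_zero intro: L2_on_add)

lemma L2_on_cong:
  assumes "\<And>t. t \<in> {a<..<b} \<Longrightarrow> f t = g t" "f \<in> L2_on a b"
  shows "g \<in> L2_on a b"
proof -
  have "(\<lambda>t. indicat_real {a<..<b} t *\<^sub>R f t) = (\<lambda>t. indicat_real {a<..<b} t *\<^sub>R g t)"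
    "(\<lambda>t. indicat_real {a<..<b} t *\<^sub>R (f t)\<^sup>2) = (\<lambda>t. indicat_real {a<..<b} t *\<^sub>R (g t)\<^sup>2)"
    using assms(1) by (auto simp: indicator_def)
  then show ?thesis
    using assms(2) by (simp add: L2_on_def set_borel_measurable_def set_integrable_def)
qed

lemma L2_on_subset:
  assumes "f \<in> L2_on a b" "a \<le> c" "d \<le> b"
  shows "f \<in> L2_on c d"
proof -
  have sub: "{c<..<d} \<subseteq> {a<..<b}" using assms by auto
  have "set_borel_measurable lborel {c<..<d} f"
    by (rule set_borel_measurable_subset[OF L2_on_borel[OF assms(1)]]) (use sub in auto)
  moreover have "intgbl c d (\<lambda>t. (f t)\<^sup>2)"
    by (rule set_integrable_subset[of _ "{a<..<b}"]) (use sub assms in \<open>auto simp: L2_on_def\<close>)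
  ultimately show ?thesis by (simp add: L2_on_def)
qed

lemma L2_on_continuous:
  assumes "continuous_on {a..b} f"
  shows "f \<in> L2_on a b"
proof -
  have *: "set_integrable lborel {a..b} g" if "continuous_on {a..b} g" for g :: "real \<Rightarrow> real"
    using that by (rule borel_integrable_atLeastAtMost')
  then have "intgbl a b g" if "continuous_on {a..b} g" for g :: "real \<Rightarrow> real"
    using set_integrable_subset[of lborel "{a..b}" g "{a<..<b}"] that by force
  from this[OF assms] this[of "\<lambda>t. (f t)\<^sup>2"] show ?thesis
    using assms by (auto simp: L2_on_def set_borel_measurable_def set_integrable_def
        intro!: continuous_intros borel_measurable_integrable)
qed

lemma L2_on_const: "(\<lambda>_. r) \<in> L2_on a b"
  by (rule L2_on_continuous) auto

lemma L2_on_integrable: "f \<in> L2_on a b \<Longrightarrow> intgbl a b f"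
  using L2_on_mult_integrable[OF _ L2_on_const[of 1]] by simp

section \<open>Affine substitution, splitting and gluing of intervals\<close>

lemma intg_affine:
  assumes "d > 0"
  shows "intg a b f = d * intg ((a - c) / d) ((b - c) / d) (\<lambda>s. f (c + d * s))"
proof -
  have "intg a b f = \<bar>d\<bar> *\<^sub>R (LINT x|lborel. indicator {a<..<b} (c + d * x) *\<^sub>R f (c + d * x))"
    unfolding set_lebesgue_integral_def using assms by (intro lborel_integral_real_affine) auto
  also have "(\<lambda>x. indicator {a<..<b} (c + d * x) *\<^sub>R f (c + d * x))
      = (\<lambda>x. indicator {(a - c) / d<..<(b - c) / d} x *\<^sub>R f (c + d * x))"
    using assms by (auto simp: indicator_def field_simps)
  finally show ?thesis using assms by (simp add: set_lebesgue_integral_def)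
qed

lemma L2_on_affine:
  assumes "f \<in> L2_on a b" "d > 0"
  shows "(\<lambda>s. f (c + d * s)) \<in> L2_on ((a - c) / d) ((b - c) / d)"
proof -
  have ind: "indicat_real {a<..<b} (c + d * x) = indicat_real {(a - c) / d<..<(b - c) / d} x" for x
    using assms by (auto simp: indicator_def field_simps)
  have "integrable lborel (\<lambda>x. indicat_real {a<..<b} x *\<^sub>R (f x)\<^sup>2)"
    using assms by (simp add: L2_on_def set_integrable_def)
  from lborel_integrable_real_affine[OF this, of d c]
  have "intgbl ((a - c) / d) ((b - c) / d) (\<lambda>x. (f (c + d * x))\<^sup>2)"
    using assms by (simp add: ind set_integrable_def)
  moreover have "(\<lambda>t. c + d * t) \<in> lborel \<rightarrow>\<^sub>M lborel" by simp
  from measurable_compose[OF this] L2_on_borel[OF assms(1)]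
  have "set_borel_measurable lborel {(a - c) / d<..<(b - c) / d} (\<lambda>x. f (c + d * x))"
    unfolding set_borel_measurable_def ind[symmetric] by blast
  ultimately show ?thesis by (simp add: L2_on_def)
qed

lemma intg_cong_AE:
  assumes "AE t in lborel. t \<in> {a<..<b} \<longrightarrow> f t = g t" "intgbl a b f" "intgbl a b g"
  shows "intg a b f = intg a b g"
  unfolding set_lebesgue_integral_def
  by (rule integral_cong_AE) (use assms in \<open>auto simp: set_integrable_def indicator_def\<close>)

lemma intg_cong: "(\<And>t. t \<in> {a<..<b} \<Longrightarrow> f t = g t) \<Longrightarrow> intg a b f = intg a b g"
  by (rule set_lebesgue_integral_cong) auto

lemma intg_split:
  assumes "a \<le> c" "c \<le> b" "intgbl a b f"
  shows "intg a b f = intg a c f + intg c b f"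
proof -
  have i: "intgbl a c f" "intgbl c b f"
    by (rule set_integrable_subset[OF assms(3)]; use assms in auto)+
  have "{a<..<c} \<union> {c<..<b} = {a<..<b} - {c} \<inter> {a<..<b}" using assms by auto
  moreover have "intg a b f = (LINT t:{a<..<c} \<union> {c<..<b}|lborel. f t)"
    unfolding set_lebesgue_integral_def
  proof (rule integral_cong_AE)
    show "(\<lambda>x. indicator ({a<..<c} \<union> {c<..<b}) x *\<^sub>R f x) \<in> borel_measurable lborel"
      using set_integrable_Un[OF i] by (simp add: set_integrable_def)
    show "AE x in lborel. indicator {a<..<b} x *\<^sub>R f x = indicator ({a<..<c} \<union> {c<..<b}) x *\<^sub>R f x"
      using AE_lborel_singleton[of c] by eventually_elim (use assms in \<open>auto simp: indicator_def\<close>)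
  qed (use assms(3) in \<open>simp add: set_integrable_def\<close>)
  moreover have "(LINT t:{a<..<c} \<union> {c<..<b}|lborel. f t) = intg a c f + intg c b f"
    by (rule set_integral_Un) (use i in auto)
  ultimately show ?thesis by simp
qed

lemma L2_on_glue:
  assumes "f \<in> L2_on a c" "f \<in> L2_on c b" "a \<le> c" "c \<le> b"
  shows "f \<in> L2_on a b"
proof -
  \<comment> \<open>The one-point term carries the value at the seam c, which lies in neither open
    subinterval.\<close>
  have eq: "(\<lambda>x. indicator {a<..<b} x *\<^sub>R g x) = (\<lambda>x. indicator {a<..<c} x *\<^sub>R g x + indicator {c<..<b} x *\<^sub>R g x
      + (if x = c then g c * indicator {a<..<b} c else 0))" for g :: "real \<Rightarrow> real"
    using assms by (auto simp: indicator_def fun_eq_iff)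
  have c0: "integrable lborel (\<lambda>x. if x = c then r else 0)" for r :: real
  proof -
    have "integrable lborel (\<lambda>x. r * indicat_real {c} x)"
      by (intro integrable_mult_right integrable_real_indicator) auto
    also have "(\<lambda>x. r * indicat_real {c} x) = (\<lambda>x. if x = c then r else 0)"
      by (auto simp: indicator_def)
    finally show ?thesis .
  qed
  show ?thesis
    using assms(1,2) c0 unfolding L2_on_def set_borel_measurable_def set_integrable_def mem_Collect_eq eq
    by (auto intro!: borel_measurable_add borel_measurable_integrable[OF c0])
qed

lemma AE_on_affine:
  fixes c d :: real
  assumes "AE t in lborel. t \<in> {a<..<b} \<longrightarrow> P t" "d > 0"
  shows "AE t in lborel. c + d * t \<in> {a<..<b} \<longrightarrow> P (c + d * t)"
proof -
  \<comment> \<open>P need not be measurable, so the pull-back is done for a measurable null set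
    that contains the exceptions.\<close>
  obtain N where N: "N \<in> null_sets lborel" "{t. \<not> (t \<in> {a<..<b} \<longrightarrow> P t)} \<subseteq> N"
    using assms(1) by (auto simp: eventually_ae_filter)
  have "AE t in lborel. t \<notin> N" using N(1) by (rule AE_not_in)
  moreover have "Measurable.pred borel (\<lambda>t. t \<notin> N)" using N(1) by (auto simp: null_sets_def)
  ultimately have "AE t in lborel. c + d * t \<notin> N"
    using AE_borel_affine[of d "\<lambda>t. t \<notin> N" c] assms by auto
  then show ?thesis by eventually_elim (use N(2) in auto)
qed

subsection \<open>Integration by parts for primitives\<close>

text \<open>Fubini for g(s) k(t) on the plane: the region s < t gives the first integral, the region
  t < s the second, and together they fill the plane up to the null diagonal.\<close>

lemma iterated_by_parts:
  fixes g k :: "real \<Rightarrow> real"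
  assumes g: "integrable lborel g" and k: "integrable lborel k"
  shows "(\<integral>t. (\<integral>s. indicator {..<t} s * g s \<partial>lborel) * k t \<partial>lborel) +
    (\<integral>t. g t * (\<integral>s. indicator {..<t} s * k s \<partial>lborel) \<partial>lborel) = (\<integral>t. g t \<partial>lborel) * (\<integral>t. k t \<partial>lborel)"
proof -
  have [measurable]: "g \<in> borel_measurable borel" "k \<in> borel_measurable borel"
    using g k by auto
  have ab: "integrable lborel (\<lambda>s. \<bar>g s\<bar>)" using g by auto
  have gk: "integrable (lborel \<Otimes>\<^sub>M lborel) (\<lambda>(s, t). g s * k t)"
  proof (rule lborel_pair.Fubini_integrable)
    show "integrable lborel (\<lambda>x. \<integral>y. norm (case (x, y) of (s, t) \<Rightarrow> g s * k t) \<partial>lborel)"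
      using ab by (simp add: abs_mult)
  qed (use k in auto)
  define A B where "A = {p :: real \<times> real. fst p < snd p}" and "B = {p :: real \<times> real. snd p < fst p}"
  have sAB [measurable]: "A \<in> sets (lborel \<Otimes>\<^sub>M lborel)" "B \<in> sets (lborel \<Otimes>\<^sub>M lborel)"
  proof -
    have "open A" "open B" unfolding A_def B_def
      by (auto intro!: open_Collect_less continuous_intros)
    then have "A \<in> sets borel" "B \<in> sets borel" by auto
    moreover have "sets (lborel \<Otimes>\<^sub>M lborel :: (real \<times> real) measure) = sets borel"
      by (metis lborel_prod sets_lborel)
    ultimately show "A \<in> sets (lborel \<Otimes>\<^sub>M lborel)" "B \<in> sets (lborel \<Otimes>\<^sub>M lborel)"
      by blast+
  qed
  have iA: "integrable (lborel \<Otimes>\<^sub>M lborel) (\<lambda>(s, t). indicat_real A (s, t) * (g s * k t))"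
   and iB: "integrable (lborel \<Otimes>\<^sub>M lborel) (\<lambda>(s, t). indicat_real B (s, t) * (g s * k t))"
    using sAB[THEN integrable_mult_indicator[OF _ gk]]
    by (simp_all add: case_prod_unfold)
  have inA: "indicat_real A (s, t) = indicator {..<t} s" and inB: "indicat_real B (s, t) = indicator {t<..} s"
    and inB': "indicat_real B (s, t) = indicator {..<s} t" for s t
    by (auto simp: A_def B_def indicator_def)
  \<comment> \<open>Removing the diagonal: for fixed t only the single point s = t is lost.\<close>
  have split: "(\<integral>s. indicator {..<t} s * g s \<partial>lborel) + (\<integral>s. indicator {t<..} s * g s \<partial>lborel) = (\<integral>s. g s \<partial>lborel)" for t
  proof -
    have i: "integrable lborel (\<lambda>s. indicator {..<t} s * g s)" "integrable lborel (\<lambda>s. indicator {t<..} s * g s)"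
      using integrable_mult_indicator[OF _ g, of "{..<t}"] integrable_mult_indicator[OF _ g, of "{t<..}"]
      by auto
    have "(\<integral>s. g s \<partial>lborel) = (\<integral>s. indicator {..<t} s * g s + indicator {t<..} s * g s \<partial>lborel)"
    proof (rule integral_cong_AE)
      show "AE x in lborel. g x = indicator {..<t} x * g x + indicator {t<..} x * g x"
        using AE_lborel_singleton[of t] by eventually_elim (auto simp: indicator_def)
    qed auto
    then show ?thesis using i by simp
  qed
  have s1: "integrable lborel (\<lambda>t. (\<integral>s. indicator {..<t} s * g s \<partial>lborel) * k t)"
    using lborel_pair.integrable_snd[OF iA] by (simp add: inA flip: mult.assoc)
  have s2: "integrable lborel (\<lambda>t. (\<integral>s. indicator {t<..} s * g s \<partial>lborel) * k t)"
    using lborel_pair.integrable_snd[OF iB] by (simp add: inB flip: mult.assoc)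
  have "(\<integral>t. (\<integral>s. indicator {t<..} s * g s \<partial>lborel) * k t \<partial>lborel)
     = (\<integral>t. (\<integral>s. indicat_real B (s, t) * (g s * k t) \<partial>lborel) \<partial>lborel)"
    by (simp add: inB flip: mult.assoc)
  also have "\<dots> = (\<integral>s. (\<integral>t. indicat_real B (s, t) * (g s * k t) \<partial>lborel) \<partial>lborel)"
    using iB by (rule lborel_pair.Fubini_integral)
  also have "\<dots> = (\<integral>s. (\<integral>t. g s * (indicator {..<s} t * k t) \<partial>lborel) \<partial>lborel)"
    by (simp add: inB' mult_ac)
  also have "\<dots> = (\<integral>s. g s * (\<integral>t. indicator {..<s} t * k t \<partial>lborel) \<partial>lborel)"
    by simp
  finally have "(\<integral>t. g t * (\<integral>s. indicator {..<t} s * k s \<partial>lborel) \<partial>lborel)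
     = (\<integral>t. (\<integral>s. indicator {t<..} s * g s \<partial>lborel) * k t \<partial>lborel)" by simp
  then have "(\<integral>t. (\<integral>s. indicator {..<t} s * g s \<partial>lborel) * k t \<partial>lborel) +
    (\<integral>t. g t * (\<integral>s. indicator {..<t} s * k s \<partial>lborel) \<partial>lborel)
    = (\<integral>t. (\<integral>s. indicator {..<t} s * g s \<partial>lborel) * k t + (\<integral>s. indicator {t<..} s * g s \<partial>lborel) * k t \<partial>lborel)"
    using s1 s2 by simp
  also have "\<dots> = (\<integral>t. (\<integral>s. g s \<partial>lborel) * k t \<partial>lborel)"
    by (simp only: split flip: distrib_right)
  finally show ?thesis by simp
qed

lemma intg_by_parts:
  assumes "intgbl a b g" "intgbl a b k"
  shows "intg a b (\<lambda>t. intg a t g * k t) + intg a b (\<lambda>t. g t * intg a t k) = intg a b g * intg a b k"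
proof -
  have e: "(\<integral>s. indicator {..<t} s * (indicator {a<..<b} s * f s) \<partial>lborel) = intg a t f"
    if "t \<in> {a<..<b}" for t f
    unfolding set_lebesgue_integral_def
    by (rule Bochner_Integration.integral_cong) (use that in \<open>auto simp: indicator_def\<close>)
  have "(\<integral>t. (\<integral>s. indicator {..<t} s * (indicator {a<..<b} s * g s) \<partial>lborel) * (indicator {a<..<b} t * k t) \<partial>lborel)
     = intg a b (\<lambda>t. intg a t g * k t)"
    "(\<integral>t. (indicator {a<..<b} t * g t) * (\<integral>s. indicator {..<t} s * (indicator {a<..<b} s * k s) \<partial>lborel) \<partial>lborel)
     = intg a b (\<lambda>t. g t * intg a t k)"
    unfolding set_lebesgue_integral_def[of _ "{a<..<b}"]
    using e by (auto intro!: Bochner_Integration.integral_cong simp: indicator_eq_0_iff)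
  with iterated_by_parts[of "\<lambda>t. indicator {a<..<b} t * g t" "\<lambda>t. indicator {a<..<b} t * k t"] assms
  show ?thesis by (simp add: set_integrable_def set_lebesgue_integral_def)
qed

lemma continuous_on_primitive:
  assumes "intgbl a b g"
  shows "continuous_on {a..b} (\<lambda>t. intg a t g)"
proof -
  have *: "g integrable_on {a<..<b}"
    using assms set_borel_integral_eq_integral(1) by blast
  then have "continuous_on {a..b} (\<lambda>t. integral {a..t} g)"
    by (intro indefinite_integral_continuous_1) (simp add: integrable_on_Icc_iff_Ioo)
  moreover have "integral {a..t} g = intg a t g" if "t \<in> {a..b}" for t
  proof -
    have "intgbl a t g" by (rule set_integrable_subset[OF assms]) (use that in auto)
    then show ?thesis
      by (simp add: set_borel_integral_eq_integral(2) integral_open_interval_real)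
  qed
  ultimately show ?thesis by (rule continuous_on_eq)
qed

subsection \<open>The fundamental lemma of the calculus of variations\<close>

text \<open>\<open>test_function\<close> asks for one continuous derivative, so a rational profile
  can replace the usual exponential one: squaring the positive part makes it C^1 across 0, and
  z^2/(1 + z^2) rises to 1 at infinity, so that its rescalings approximate an indicator.\<close>

definition cutoff :: "real \<Rightarrow> real" where
  "cutoff x = (max 0 x)\<^sup>2 / (1 + (max 0 x)\<^sup>2)"

definition cutoff' :: "real \<Rightarrow> real" where
  "cutoff' x = 2 * max 0 x / (1 + (max 0 x)\<^sup>2)\<^sup>2"

lemma one_plus_square_neq_0 [simp]: "1 + (x::real)\<^sup>2 \<noteq> 0"
  by (smt (verit) zero_le_power2)

text \<open>Only x = 0 needs an argument, where the difference quotient is bounded by |h|; elsewhere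
  the function agrees locally with 0 or with x^2.\<close>

lemma has_field_derivative_max_0_square:
  "((\<lambda>x::real. (max 0 x)\<^sup>2) has_field_derivative 2 * max 0 x) (at x)"
proof -
  consider "x < 0" | "x = 0" | "x > 0" by linarith
  then show ?thesis
  proof cases
    case 1
    have "((\<lambda>x::real. 0) has_field_derivative 2 * max 0 x) (at x)" using 1 by simp
    then show ?thesis
      by (rule has_field_derivative_transform_within_open[of _ _ _ "{..<0}"]) (use 1 in auto)
  next
    case 2
    have "((\<lambda>h::real. (max 0 h)\<^sup>2 / h) \<longlongrightarrow> 0) (at 0)"
    proof (rule tendsto_0_le[where K = 1])
      show "((\<lambda>h::real. h) \<longlongrightarrow> 0) (at 0)" by (rule tendsto_ident_at)
      have "norm ((max 0 h)\<^sup>2 / h) \<le> norm h * 1" for h :: real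
        by (cases "h > 0") (auto simp: power2_eq_square max_def)
      then show "\<forall>\<^sub>F h in at 0. norm ((max 0 h)\<^sup>2 / h) \<le> norm (h::real) * 1" by simp
    qed
    then show ?thesis using 2 by (simp add: DERIV_def)
  next
    case 3
    have "((\<lambda>x::real. x\<^sup>2) has_field_derivative 2 * max 0 x) (at x)"
      using 3 by (auto intro!: derivative_eq_intros)
    then show ?thesis
      by (rule has_field_derivative_transform_within_open[of _ _ _ "{0<..}"]) (use 3 in auto)
  qed
qed

lemma has_field_derivative_cutoff: "(cutoff has_field_derivative cutoff' x) (at x)"
proof -
  define w where "w = (\<lambda>x::real. (max 0 x)\<^sup>2)"
  have w: "(w has_field_derivative 2 * max 0 x) (at x)"
    unfolding w_def by (rule has_field_derivative_max_0_square)
  have nz: "1 + w x \<noteq> 0" by (simp add: w_def)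
  have "((\<lambda>x. w x / (1 + w x)) has_field_derivative
      (2 * max 0 x * (1 + w x) - w x * (0 + 2 * max 0 x)) / ((1 + w x) * (1 + w x))) (at x)"
    by (intro DERIV_divide DERIV_add w DERIV_const nz)
  moreover have "2 * max 0 x * (1 + w x) - w x * (0 + 2 * max 0 x) = 2 * max 0 x"
    by (simp add: algebra_simps)
  ultimately show ?thesis
    by (simp add: w_def cutoff_def[abs_def] cutoff'_def power2_eq_square)
qed

lemma continuous_on_cutoff': "continuous_on S cutoff'"
  unfolding cutoff'_def[abs_def] by (intro continuous_intros) auto

lemma cutoff_bounds: "0 \<le> cutoff x" "cutoff x \<le> 1"
  by (simp_all add: cutoff_def add_nonneg_nonneg divide_le_eq_1 add_pos_nonneg)

lemma cutoff_nonpos: "x \<le> 0 \<Longrightarrow> cutoff x = 0"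
  by (simp add: cutoff_def)

text \<open>For z >= 0 the cutoff equals 1 - 1/(1 + z^2), and n x - 1 exceeds every bound because x
  > 0.\<close>

lemma tendsto_cutoff:
  assumes "x > 0"
  shows "(\<lambda>n. cutoff (real n * x - 1)) \<longlonglongrightarrow> 1"
proof -
  have lin: "filterlim (\<lambda>n. - 1 + real n * x) at_top sequentially"
    by (intro filterlim_tendsto_add_at_top[OF tendsto_const]
        filterlim_at_top_mult_tendsto_pos[OF tendsto_const assms] filterlim_real_sequentially)
  then have "filterlim (\<lambda>n. 1 + (- 1 + real n * x)\<^sup>2) at_top sequentially"
    by (intro filterlim_tendsto_add_at_top[OF tendsto_const] filterlim_pow_at_top[OF _ lin]) simp
  from tendsto_diff[OF tendsto_const[of 1] tendsto_inverse_0_at_top[OF this]]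
  have "(\<lambda>n. 1 - inverse (1 + (- 1 + real n * x)\<^sup>2)) \<longlonglongrightarrow> 1" by simp
  moreover have "1 - inverse (1 + z\<^sup>2) = cutoff z" if "z \<ge> 0" for z
    using that by (simp add: cutoff_def field_simps)
  then have "\<forall>\<^sub>F n in sequentially. 1 - inverse (1 + (- 1 + real n * x)\<^sup>2) = cutoff (real n * x - 1)"
    using filterlim_at_top[THEN iffD1, OF lin, rule_format, of 0]
    by (auto elim!: eventually_mono simp: add.commute)
  ultimately show ?thesis by (rule Lim_transform_eventually)
qed

text \<open>The shift by \<open>1\<close> keeps the support inside the compact set \<open>{c + 1/n..d - 1/n}\<close>.\<close>

definition bump :: "real \<Rightarrow> real \<Rightarrow> nat \<Rightarrow> real \<Rightarrow> real" where
  "bump c d n t = cutoff (real n * (t - c) - 1) * cutoff (real n * (d - t) - 1)"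

lemma bump_eq_0: "t \<notin> {c<..<d} \<Longrightarrow> bump c d n t = 0"
proof -
  assume "t \<notin> {c<..<d}"
  then have "real n * (t - c) \<le> 0 \<or> real n * (d - t) \<le> 0"
    by (auto simp: mult_le_0_iff)
  then show ?thesis by (auto simp: bump_def cutoff_nonpos)
qed

lemma bump_bounds: "0 \<le> bump c d n t" "bump c d n t \<le> 1"
  using cutoff_bounds by (auto simp: bump_def intro: mult_le_one)

lemma tendsto_bump: "(\<lambda>n. bump c d n t) \<longlonglongrightarrow> indicator {c<..<d} t"
proof (cases "t \<in> {c<..<d}")
  case True
  then have "(\<lambda>n. bump c d n t) \<longlonglongrightarrow> 1 * 1"
    unfolding bump_def by (intro tendsto_mult tendsto_cutoff) auto
  then show ?thesis using True by simp
qed (simp add: bump_eq_0)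

lemma has_field_derivative_bump:
  "(bump c d n has_field_derivative
    (real n * cutoff' (real n * (t - c) - 1) * cutoff (real n * (d - t) - 1)
     - cutoff (real n * (t - c) - 1) * (real n * cutoff' (real n * (d - t) - 1)))) (at t)"
proof -
  have "((\<lambda>t. cutoff (real n * (t - c) - 1)) has_field_derivative
      cutoff' (real n * (t - c) - 1) * real n) (at t)"
    by (rule DERIV_chain2[OF has_field_derivative_cutoff]) (auto intro!: derivative_eq_intros)
  moreover have "((\<lambda>t. cutoff (real n * (d - t) - 1)) has_field_derivative
      cutoff' (real n * (d - t) - 1) * (- real n)) (at t)"
    by (rule DERIV_chain2[OF has_field_derivative_cutoff]) (auto intro!: derivative_eq_intros)
  ultimately show ?thesis
    unfolding bump_def[abs_def]
    by (auto intro!: derivative_eq_intros)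
qed

section \<open>Compactly supported C^1 test functions\<close>

lemma test_functionI:
  assumes "\<And>t. (\<phi> has_field_derivative \<phi>' t) (at t)" "continuous_on UNIV \<phi>'"
    "a < c" "d < b" "\<And>t. t \<notin> {c..d} \<Longrightarrow> \<phi> t = 0"
  shows "test_function a b \<phi>"
proof -
  have "deriv \<phi> = \<phi>'" using assms(1) by (auto intro: DERIV_imp_deriv)
  moreover have "\<forall>t. \<phi> differentiable (at t)"
    using assms(1) real_differentiable_def by blast
  moreover have "compact {c..d} \<and> {c..d} \<subseteq> {a<..<b} \<and> (\<forall>t. t \<notin> {c..d} \<longrightarrow> \<phi> t = 0)"
    using assms by auto
  ultimately show ?thesis unfolding test_function_def using assms(2) by metis
qed

lemma test_function_DERIV:
  "test_function a b \<phi> \<Longrightarrow> (\<phi> has_field_derivative deriv \<phi> t) (at t)"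
  by (simp add: test_function_def DERIV_deriv_iff_real_differentiable)

lemma test_function_continuous:
  assumes "test_function a b \<phi>"
  shows "continuous_on S \<phi>" "continuous_on S (deriv \<phi>)"
proof -
  show "continuous_on S \<phi>"
    by (intro continuous_at_imp_continuous_on ballI DERIV_isCont[OF test_function_DERIV[OF assms]])
  show "continuous_on S (deriv \<phi>)"
    using assms continuous_on_subset by (auto simp: test_function_def)
qed

lemma test_function_support:
  assumes "test_function a b \<phi>" "a < b"
  obtains c d where "a < c" "c \<le> d" "d < b" "\<And>t. t \<notin> {c..d} \<Longrightarrow> \<phi> t = 0"
proof -
  obtain K where K: "compact K" "K \<subseteq> {a<..<b}" "\<And>t. t \<notin> K \<Longrightarrow> \<phi> t = 0"
    using assms by (auto simp: test_function_def)
  show thesis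
  proof (cases "K = {}")
    case True
    \<comment> \<open>An empty support still has to be enclosed in an interval; the midpoint of (a,
      b) serves.\<close>
    then show thesis using that[of "(a+b)/2" "(a+b)/2"] K assms by auto
  next
    case False
    obtain c where c: "c \<in> K" "\<And>t. t \<in> K \<Longrightarrow> c \<le> t"
      using compact_attains_inf[OF K(1) False] by auto
    obtain d where d: "d \<in> K" "\<And>t. t \<in> K \<Longrightarrow> t \<le> d"
      using compact_attains_sup[OF K(1) False] by auto
    have "\<phi> t = 0" if "t \<notin> {c..d}" for t
      using that c(2)[of t] d(2)[of t] by (intro K(3)) auto
    with that[of c d] c d K show thesis by (meson greaterThanLessThan_iff subsetD)
  qed
qed

lemma test_function_outside:
  assumes "test_function a b \<phi>" "t \<notin> {a<..<b}"
  shows "\<phi> t = 0"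
  using assms unfolding test_function_def by (meson subsetD)

lemma test_function_bump:
  assumes "a \<le> c" "d \<le> b" "n > 0"
  shows "test_function a b (bump c d n)"
proof (rule test_functionI[OF has_field_derivative_bump])
  have "continuous_on UNIV cutoff"
    by (intro continuous_at_imp_continuous_on ballI DERIV_isCont[OF has_field_derivative_cutoff])
  then have c: "continuous_on UNIV (\<lambda>t. cutoff (f t))" "continuous_on UNIV (\<lambda>t. cutoff' (f t))"
    if "continuous_on UNIV f" for f
    using that continuous_on_cutoff'[of UNIV]
    by (auto intro: continuous_on_compose2)
  then show "continuous_on UNIV (\<lambda>t. real n * cutoff' (real n * (t - c) - 1) * cutoff (real n * (d - t) - 1)
     - cutoff (real n * (t - c) - 1) * (real n * cutoff' (real n * (d - t) - 1)))"
    by (intro continuous_intros c)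
  have "1 / real n > 0" using assms by simp
  then show "a < c + 1 / n" using assms by linarith
  show "d - 1 / n < b" using \<open>1 / real n > 0\<close> assms by linarith
  fix t assume "t \<notin> {c + 1 / n..d - 1 / n}"
  then have "t - c \<le> 1 / n \<or> d - t \<le> 1 / n" by auto
  then have "real n * (t - c) - 1 \<le> 0 \<or> real n * (d - t) - 1 \<le> 0"
    using assms(3) by (auto simp: field_simps)
  then show "bump c d n t = 0" by (auto simp: bump_def cutoff_nonpos)
qed

text \<open>The Borel sets over which u integrates to 0 form a Dynkin system, open intervals are an
  intersection-stable generator, and a density is determined a.e. by its integrals.\<close>

lemma zero_AE_of_interval_integrals:
  fixes u :: "real \<Rightarrow> real"
  assumes u: "integrable lborel u" and 0: "\<And>c d. (LINT t:{c<..<d}|lborel. u t) = 0"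
  shows "AE t in lborel. u t = 0"
proof (rule density_unique_real)
  show "integrable lborel u" "integrable lborel (\<lambda>_::real. 0::real)" using u by auto
  have si: "set_integrable lborel A u" if "A \<in> sets borel" for A
    unfolding set_integrable_def using integrable_mult_indicator[OF _ u] that by auto
  \<comment> \<open>Needed for complements in the induction: the integral over the line is the limit
    of those over (-n, n).\<close>
  have whole: "(LINT t|lborel. u t) = 0"
  proof (rule LIMSEQ_unique)
    show "(\<lambda>n. LINT t:{- real n<..<real n}|lborel. u t) \<longlonglongrightarrow> (LINT t|lborel. u t)"
      unfolding set_lebesgue_integral_def
    proof (rule integral_dominated_convergence[where w = "\<lambda>t. \<bar>u t\<bar>"])
      show "AE x in lborel. (\<lambda>n. indicat_real {- real n<..<real n} x *\<^sub>R u x) \<longlonglongrightarrow> u x"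
      proof (intro AE_I2 tendsto_eventually)
        fix x :: real
        obtain N where "\<bar>x\<bar> < real N" using reals_Archimedean2 by blast
        then show "\<forall>\<^sub>F n in sequentially. indicat_real {- real n<..<real n} x *\<^sub>R u x = u x"
          by (intro eventually_sequentiallyI[of N]) (auto simp: indicator_def abs_less_iff)
      qed
    qed (use u in \<open>auto simp: indicator_def\<close>)
  qed (simp add: 0)
  fix A :: "real set" assume "A \<in> sets lborel"
  then have "Int_stable (range (\<lambda>(a, b). box a b :: real set))"
    "range (\<lambda>(a, b). box a b :: real set) \<subseteq> Pow UNIV"
    "A \<in> sigma_sets UNIV (range (\<lambda>(a, b). box a b))"
    by (auto simp: Int_stable_def borel_eq_box)
  then have "(LINT t:A|lborel. u t) = 0"
  proof (induction rule: sigma_sets_induct_disjoint)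
    case (basic A) then show ?case using 0 by auto
  next
    case empty then show ?case by (simp add: set_lebesgue_integral_def)
  next
    case (compl A)
    then have A: "A \<in> sets borel" by (simp add: borel_eq_box)
    have "(LINT t:A \<union> (UNIV - A)|lborel. u t) = (LINT t:A|lborel. u t) + (LINT t:UNIV - A|lborel. u t)"
      by (rule set_integral_Un) (use A si in auto)
    then show ?case using whole compl by (simp add: set_lebesgue_integral_def)
  next
    case (union F)
    then have F: "F i \<in> sets borel" for i by (auto simp: borel_eq_box)
    have "(LINT t:(\<Union>i. F i)|lborel. u t) = (\<Sum>i. LINT t:F i|lborel. u t)"
      by (rule lebesgue_integral_countable_add) (use F si union in \<open>auto simp: disjoint_family_on_def\<close>)
    then show ?case using union by simp
  qed
  then show "(LINT t:A|lborel. u t) = (LINT t:A|lborel. 0)" by simp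
qed

text \<open>Bumps tend boundedly to indicators of intervals, so dominated convergence with bound |u|
  turns the hypothesis into vanishing integrals over all intervals.\<close>

lemma fundamental_lemma:
  assumes u: "intgbl a b u" and 0: "\<And>\<phi>. test_function a b \<phi> \<Longrightarrow> intg a b (\<lambda>t. u t * \<phi> t) = 0"
  shows "AE t in lborel. t \<in> {a<..<b} \<longrightarrow> u t = 0"
proof -
  define U where "U t = indicator {a<..<b} t * u t" for t
  have U: "integrable lborel U" using u by (simp add: U_def[abs_def] set_integrable_def)
  have "(LINT t:{c<..<d}|lborel. U t) = 0" for c d
  proof -
    \<comment> \<open>\<open>U\<close> vanishes outside (a, b), so an arbitrary (c, d) may be
      clipped to [a, b], where its bumps are test functions.\<close>
    define c' d' where "c' = max a c" and "d' = min b d"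
    have 0: "(LINT t|lborel. U t * bump c' d' (Suc n) t) = 0" for n
      using 0[OF test_function_bump[of a c' d' b "Suc n"]]
      by (simp add: U_def c'_def d'_def set_lebesgue_integral_def mult.assoc)
    have "(\<lambda>n. LINT t|lborel. U t * bump c' d' (Suc n) t) \<longlonglongrightarrow> (LINT t|lborel. U t * indicator {c'<..<d'} t)"
    proof (rule integral_dominated_convergence[where w = "\<lambda>t. \<bar>U t\<bar>"])
      show "AE x in lborel. (\<lambda>n. U x * bump c' d' (Suc n) x) \<longlonglongrightarrow> U x * indicat_real {c'<..<d'} x"
        by (intro AE_I2 tendsto_mult tendsto_const LIMSEQ_Suc tendsto_bump)
      have "norm (U x * bump c' d' (Suc n) x) \<le> \<bar>U x\<bar>" for n x
        using bump_bounds[of c' d' "Suc n" x] by (auto simp: abs_mult intro: mult_left_le)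
      then show "AE x in lborel. norm (U x * bump c' d' (Suc n) x) \<le> \<bar>U x\<bar>" for n by simp
      have "bump c' d' (Suc n) \<in> borel_measurable borel" for n
        by (intro borel_measurable_continuous_onI continuous_at_imp_continuous_on ballI)
          (meson DERIV_isCont has_field_derivative_bump)
      then show "(\<lambda>t. U t * bump c' d' (Suc n) t) \<in> borel_measurable lborel" for n
        using U by auto
    qed (use U in auto)
    then have "(LINT t|lborel. U t * indicator {c'<..<d'} t) = 0"
      by (simp add: 0 LIMSEQ_const_iff)
    moreover have "(\<lambda>t. U t * indicator {c'<..<d'} t) = (\<lambda>t. indicator {c<..<d} t * U t)"
      by (auto simp: U_def c'_def d'_def indicator_def)
    ultimately show ?thesis by (simp add: set_lebesgue_integral_def)
  qed
  from zero_AE_of_interval_integrals[OF U this] show ?thesis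
    by eventually_elim (auto simp: U_def indicator_def)
qed

subsection \<open>Sobolev functions on an interval as primitives\<close>

lemma set_lebesgue_integral_empty [simp]: "set_lebesgue_integral M {} f = 0"
  by (simp add: set_lebesgue_integral_def)

text \<open>W_2^1 in its classical form: absolutely continuous with square-integrable derivative.
  The derivative g is an explicit partner, so that computations avoid the arbitrary choice inside
  \<open>weak_deriv\<close>; the identity is required on the whole closed interval, so that
  end-point values are meaningful.\<close>

definition is_primitive :: "real \<Rightarrow> real \<Rightarrow> (real \<Rightarrow> real) \<Rightarrow> (real \<Rightarrow> real) \<Rightarrow> bool" where
  "is_primitive a b f g \<longleftrightarrow> g \<in> L2_on a b \<and> (\<forall>t\<in>{a..b}. f t = f a + intg a t g)"

lemma is_primitive_L2: "is_primitive a b f g \<Longrightarrow> g \<in> L2_on a b"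
  by (simp add: is_primitive_def)

lemma is_primitive_eq: "is_primitive a b f g \<Longrightarrow> t \<in> {a..b} \<Longrightarrow> f t = f a + intg a t g"
  unfolding is_primitive_def by blast

text \<open>At t = a the integral is over the empty interval, which identifies C as f a.\<close>

lemma is_primitiveI:
  assumes "g \<in> L2_on a b" "\<And>t. t \<in> {a..b} \<Longrightarrow> f t = C + intg a t g"
  shows "is_primitive a b f g"
  unfolding is_primitive_def
proof (intro conjI ballI)
  fix t assume "t \<in> {a..b}"
  with assms(2)[of t] assms(2)[of a] show "f t = f a + intg a t g" by simp
qed (rule assms)

lemma is_primitive_integrable:
  assumes "is_primitive a b f g" "a \<le> c" "d \<le> b"
  shows "intgbl c d g"
  using L2_on_subset[OF is_primitive_L2[OF assms(1)] assms(2,3)] by (rule L2_on_integrable)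

lemma is_primitive_continuous:
  assumes "is_primitive a b f g"
  shows "continuous_on {a..b} f"
proof -
  have "continuous_on {a..b} (\<lambda>t. f a + intg a t g)"
    using assms by (intro continuous_intros continuous_on_primitive L2_on_integrable is_primitive_L2)
  then show ?thesis
    by (rule continuous_on_eq) (simp add: is_primitive_eq[OF assms, symmetric])
qed

lemma is_primitive_cong:
  assumes f: "is_primitive a b f g" and h: "\<And>t. t \<in> {a..b} \<Longrightarrow> h t = f t"
  shows "is_primitive a b h g"
  by (rule is_primitiveI[OF is_primitive_L2[OF f], of _ "f a"])
    (simp add: h is_primitive_eq[OF f, symmetric])

lemma is_primitive_add:
  assumes f: "is_primitive a b f g" and h: "is_primitive a b h k"
  shows "is_primitive a b (\<lambda>t. f t + h t) (\<lambda>t. g t + k t)"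
proof (rule is_primitiveI)
  show "(\<lambda>t. g t + k t) \<in> L2_on a b" using f h by (intro L2_on_add is_primitive_L2)
  fix t assume t: "t \<in> {a..b}"
  then have "intg a t (\<lambda>t. g t + k t) = intg a t g + intg a t k"
    by (intro set_integral_add(2) is_primitive_integrable[OF f] is_primitive_integrable[OF h]) auto
  with is_primitive_eq[OF f t] is_primitive_eq[OF h t]
  show "f t + h t = (f a + h a) + intg a t (\<lambda>t. g t + k t)" by linarith
qed

lemma is_primitive_cmult:
  assumes f: "is_primitive a b f g"
  shows "is_primitive a b (\<lambda>t. r * f t) (\<lambda>t. r * g t)"
proof (rule is_primitiveI)
  show "(\<lambda>t. r * g t) \<in> L2_on a b" using f by (intro L2_on_cmult is_primitive_L2)
  fix t assume "t \<in> {a..b}"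
  from is_primitive_eq[OF f this] show "r * f t = r * f a + intg a t (\<lambda>t. r * g t)"
    by (metis distrib_left set_integral_mult_right)
qed

lemma is_primitive_zero: "is_primitive a b (\<lambda>_. 0) (\<lambda>_. 0)"
  by (simp add: is_primitive_def L2_on_zero)

lemma is_primitive_subinterval:
  assumes f: "is_primitive a b f g" and "c \<le> b"
  shows "is_primitive a c f g"
proof (rule is_primitiveI)
  show "g \<in> L2_on a c" using L2_on_subset[OF is_primitive_L2[OF f] order_refl \<open>c \<le> b\<close>] .
  show "f t = f a + intg a t g" if "t \<in> {a..c}" for t
    using that \<open>c \<le> b\<close> by (intro is_primitive_eq[OF f]) auto
qed

text \<open>Writing f and h as starting value plus integral, the constants integrate directly and
  \<open>intg_by_parts\<close> handles the product of the two integrals.\<close>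

lemma is_primitive_by_parts:
  assumes f: "is_primitive a b f g" and h: "is_primitive a b h k" and "a \<le> b"
  shows "intg a b (\<lambda>t. f t * k t) + intg a b (\<lambda>t. g t * h t) = f b * h b - f a * h a"
proof -
  have L: "intgbl a b g" "intgbl a b k"
    using f h by (auto intro: L2_on_integrable is_primitive_L2)
  have P: "(\<lambda>t. intg a t g) \<in> L2_on a b" "(\<lambda>t. intg a t k) \<in> L2_on a b"
    using L by (auto intro: L2_on_continuous continuous_on_primitive)
  have i: "intgbl a b (\<lambda>t. intg a t g * k t)" "intgbl a b (\<lambda>t. g t * intg a t k)"
    using P f h by (auto intro: L2_on_mult_integrable is_primitive_L2)
  have "intg a b (\<lambda>t. f t * k t) = intg a b (\<lambda>t. f a * k t + intg a t g * k t)"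
    by (rule intg_cong) (simp add: is_primitive_eq[OF f, symmetric] flip: distrib_right)
  also have "\<dots> = f a * intg a b k + intg a b (\<lambda>t. intg a t g * k t)"
    using L i by simp
  finally have 1: "intg a b (\<lambda>t. f t * k t) = f a * intg a b k + intg a b (\<lambda>t. intg a t g * k t)" .
  have "intg a b (\<lambda>t. g t * h t) = intg a b (\<lambda>t. g t * h a + g t * intg a t k)"
    by (rule intg_cong) (simp add: is_primitive_eq[OF h, symmetric] flip: distrib_left)
  also have "\<dots> = intg a b g * h a + intg a b (\<lambda>t. g t * intg a t k)"
    using L i by simp
  finally have 2: "intg a b (\<lambda>t. g t * h t) = intg a b g * h a + intg a b (\<lambda>t. g t * intg a t k)" .
  have "f b = f a + intg a b g" "h b = h a + intg a b k"
    using is_primitive_eq[OF f, of b] is_primitive_eq[OF h, of b] \<open>a \<le> b\<close> by auto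
  with 1 2 intg_by_parts[OF L] show ?thesis by (simp add: algebra_simps)
qed

lemma intg_FTC:
  assumes "\<And>t. (F has_field_derivative f t) (at t)" "continuous_on UNIV f" "a \<le> b"
  shows "intg a b f = F b - F a"
proof -
  have f: "continuous_on S f" for S using assms(2) continuous_on_subset by blast
  have "integral\<^sup>L lborel (\<lambda>x. indicator {a..b} x *\<^sub>R f x) = F b - F a"
    using assms f
    by (intro integral_FTC_atLeastAtMost)
      (auto simp: has_real_derivative_iff_has_vector_derivative intro: has_vector_derivative_at_within)
  moreover have "integral\<^sup>L lborel (\<lambda>x. indicator {a..b} x *\<^sub>R f x) = intg a b f"
    unfolding set_lebesgue_integral_def
  proof (rule integral_cong_AE)
    show "AE x in lborel. indicat_real {a..b} x *\<^sub>R f x = indicat_real {a<..<b} x *\<^sub>R f x"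
      using AE_lborel_singleton[of a] AE_lborel_singleton[of b]
      by eventually_elim (auto simp: indicator_def)
    have "f \<in> borel_measurable borel" by (intro borel_measurable_continuous_onI f)
    then show "(\<lambda>x. indicat_real {a..b} x *\<^sub>R f x) \<in> borel_measurable lborel"
      "(\<lambda>x. indicat_real {a<..<b} x *\<^sub>R f x) \<in> borel_measurable lborel" by auto
  qed
  ultimately show ?thesis by simp
qed

text \<open>The right end B is free because a test function is C^1 on the whole line: a bump
  supported in (0, l_j) has to count as a function on the full edge up to T_j.\<close>

lemma test_function_is_primitive:
  assumes "test_function a b \<phi>"
  shows "is_primitive a B \<phi> (deriv \<phi>)"
proof (rule is_primitiveI)
  show "deriv \<phi> \<in> L2_on a B"
    by (intro L2_on_continuous test_function_continuous[OF assms])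
  show "\<phi> t = \<phi> a + intg a t (deriv \<phi>)" if "t \<in> {a..B}" for t
    using intg_FTC[OF test_function_DERIV[OF assms] test_function_continuous(2)[OF assms], of a t] that by simp
qed

lemma is_primitive_weak_deriv:
  assumes "is_primitive a b f g" "a \<le> b"
  shows "is_weak_deriv a b f g"
  unfolding is_weak_deriv_def
proof (intro allI impI)
  fix \<phi> assume t: "test_function a b \<phi>"
  have "\<phi> a = 0" "\<phi> b = 0" using test_function_outside[OF t] by auto
  with is_primitive_by_parts[OF assms(1) test_function_is_primitive[OF t] assms(2)]
  show "intg a b (\<lambda>t. f t * deriv \<phi> t) = - intg a b (\<lambda>t. g t * \<phi> t)" by simp
qed

text \<open>Off the support of \<psi> an antiderivative is constant on either side; the zero mean
  makes the two constants equal, so subtracting one of them leaves compact support.\<close>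

lemma test_function_antiderivative:
  assumes \<psi>: "test_function a b \<psi>" and 0: "intg a b \<psi> = 0" and "a < b"
  obtains \<phi> where "test_function a b \<phi>" "deriv \<phi> = \<psi>"
proof -
  \<comment> \<open>Infinite end points give one antiderivative on the whole line, since
    \<open>test_function\<close> demands differentiability everywhere.\<close>
  have "\<exists>F. \<forall>x::real. -\<infinity> < ereal x \<longrightarrow> ereal x < \<infinity> \<longrightarrow> (F has_vector_derivative \<psi> x) (at x)"
    by (rule einterval_antiderivative)
      (auto intro: continuous_on_interior DERIV_isCont test_function_DERIV[OF \<psi>])
  then obtain F where F: "\<And>x. (F has_field_derivative \<psi> x) (at x)"
    by (auto simp: has_real_derivative_iff_has_vector_derivative)
  have FTC: "intg s t \<psi> = F t - F s" if "s \<le> t" for s t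
    using intg_FTC[OF F test_function_continuous(1)[OF \<psi>] that] .
  obtain c d where cd: "a < c" "c \<le> d" "d < b" "\<And>t. t \<notin> {c..d} \<Longrightarrow> \<psi> t = 0"
    using test_function_support[OF \<psi> \<open>a < b\<close>] by blast
  have null: "F s = F t" if "s \<le> t" "t \<le> c \<or> d \<le> s" for s t
  proof -
    have "intg s t \<psi> = intg s t (\<lambda>_. 0)" by (rule intg_cong) (use that cd in auto)
    then show ?thesis using FTC[OF that(1)] by simp
  qed
  define \<phi> where "\<phi> t = F t - F a" for t
  have D: "(\<phi> has_field_derivative \<psi> t) (at t)" for t
    unfolding \<phi>_def by (rule DERIV_cong[OF DERIV_diff[OF F DERIV_const]]) simp
  have ab: "F b = F a" using FTC[of a b] 0 \<open>a < b\<close> by simp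
  have "test_function a b \<phi>"
  proof (rule test_functionI[OF D _ cd(1,3)])
    show "continuous_on UNIV \<psi>" by (rule test_function_continuous(1)[OF \<psi>])
    fix t assume "t \<notin> {c..d}"
    then consider "t \<le> a" | "a \<le> t" "t \<le> c" | "d \<le> t" "t \<le> b" | "b \<le> t" by force
    then have "F t = F a"
    proof cases
      case 1 then show ?thesis using null[of t a] cd by simp
    next
      case 2 then show ?thesis using null[of a t] by simp
    next
      case 3 then show ?thesis using null[of t b] ab by simp
    next
      case 4 then show ?thesis using null[of b t] ab cd by simp
    qed
    then show "\<phi> t = 0" by (simp add: \<phi>_def)
  qed
  moreover have "deriv \<phi> = \<psi>" using D by (auto intro: DERIV_imp_deriv)
  ultimately show thesis by (rule that)
qed

lemma test_function_linear:
  assumes "test_function a b \<phi>" "test_function a b \<psi>" "a < b"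
  shows "test_function a b (\<lambda>t. \<phi> t - r * \<psi> t)"
proof -
  obtain c d where cd: "a < c" "c \<le> d" "d < b" "\<And>t. t \<notin> {c..d} \<Longrightarrow> \<phi> t = 0"
    using test_function_support assms by blast
  obtain c' d' where cd': "a < c'" "c' \<le> d'" "d' < b" "\<And>t. t \<notin> {c'..d'} \<Longrightarrow> \<psi> t = 0"
    using test_function_support assms by blast
  show ?thesis
  proof (rule test_functionI)
    show "((\<lambda>t. \<phi> t - r * \<psi> t) has_field_derivative deriv \<phi> t - r * deriv \<psi> t) (at t)" for t
      by (intro DERIV_diff DERIV_cmult test_function_DERIV[OF assms(1)] test_function_DERIV[OF assms(2)])
    show "continuous_on UNIV (\<lambda>t. deriv \<phi> t - r * deriv \<psi> t)"
      using assms by (intro continuous_intros test_function_continuous)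
    show "a < min c c'" "max d d' < b" using cd cd' by auto
    show "\<phi> t - r * \<psi> t = 0" if "t \<notin> {min c c'..max d d'}" for t
    proof -
      have "\<phi> t = 0" by (rule cd(4)) (use that in auto)
      moreover have "\<psi> t = 0" by (rule cd'(4)) (use that in auto)
      ultimately show ?thesis by simp
    qed
  qed
qed

text \<open>Subtracting a multiple of one fixed test function \<open>\<psi>\<close> with nonzero integral turns any test
  function into the derivative of a test function.\<close>

lemma constant_AE_of_weak_deriv_zero:
  assumes u: "u \<in> L2_on a b" and "a < b"
    and 0: "\<And>\<phi>. test_function a b \<phi> \<Longrightarrow> intg a b (\<lambda>t. u t * deriv \<phi> t) = 0"
  obtains C where "AE t in lborel. t \<in> {a<..<b} \<longrightarrow> u t = C"
proof -
  have L2: "\<phi> \<in> L2_on a b" if "test_function a b \<phi>" for \<phi>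
    using test_function_continuous(1)[OF that] by (rule L2_on_continuous)
  \<comment> \<open>Otherwise the fundamental lemma for the constant 1 would make (a, b) a null
    set.\<close>
  have "\<exists>\<psi>. test_function a b \<psi> \<and> intg a b \<psi> \<noteq> 0"
  proof (rule ccontr)
    assume "\<not> ?thesis"
    then have "AE t in lborel. t \<in> {a<..<b} \<longrightarrow> (1::real) = 0"
      by (intro fundamental_lemma) (auto intro: L2_on_integrable L2_on_const)
    then have "emeasure lborel {a<..<b} = 0"
      by (subst (asm) AE_iff_measurable[of "{a<..<b}"]) auto
    then show False using \<open>a < b\<close> by simp
  qed
  then obtain \<psi> where \<psi>: "test_function a b \<psi>" "intg a b \<psi> \<noteq> 0" by blast
  \<comment> \<open>If u is constant, testing it against \<psi> forces this value.\<close>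
  define C where "C = intg a b (\<lambda>t. u t * \<psi> t) / intg a b \<psi>"
  have "AE t in lborel. t \<in> {a<..<b} \<longrightarrow> u t - C = 0"
  proof (rule fundamental_lemma)
    show "intgbl a b (\<lambda>t. u t - C)"
      by (intro set_integral_diff(1) L2_on_integrable u L2_on_const)
    fix \<phi> assume \<phi>: "test_function a b \<phi>"
    define r where "r = intg a b \<phi> / intg a b \<psi>"
    have i: "intgbl a b \<phi>" "intgbl a b \<psi>" "intgbl a b (\<lambda>t. u t * \<phi> t)" "intgbl a b (\<lambda>t. u t * \<psi> t)"
      using u L2 \<phi> \<psi> by (auto intro: L2_on_integrable L2_on_mult_integrable)
    have "intg a b (\<lambda>t. \<phi> t - r * \<psi> t) = 0"
      using i \<psi>(2) by (simp add: r_def)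
    from test_function_antiderivative[OF test_function_linear[OF \<phi> \<psi>(1) \<open>a < b\<close>] this \<open>a < b\<close>]
    obtain \<Phi> where "test_function a b \<Phi>" "deriv \<Phi> = (\<lambda>t. \<phi> t - r * \<psi> t)" by blast
    with 0[of \<Phi>] have "intg a b (\<lambda>t. u t * \<phi> t - r * (u t * \<psi> t)) = 0"
      by (simp add: algebra_simps)
    then have "intg a b (\<lambda>t. u t * \<phi> t) = r * intg a b (\<lambda>t. u t * \<psi> t)" using i by simp
    also have "\<dots> = C * intg a b \<phi>" by (simp add: r_def C_def)
    finally show "intg a b (\<lambda>t. (u t - C) * \<phi> t) = 0"
      using i by (simp add: left_diff_distrib)
  qed
  then show thesis by (intro that[of C]) auto
qed

section \<open>Uniqueness of weak derivatives and continuous representatives\<close>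

lemma weak_deriv_unique:
  assumes "is_weak_deriv a b f g" "is_weak_deriv a b f h" "g \<in> L2_on a b" "h \<in> L2_on a b"
  shows "AE t in lborel. t \<in> {a<..<b} \<longrightarrow> g t = h t"
proof -
  have "AE t in lborel. t \<in> {a<..<b} \<longrightarrow> g t - h t = 0"
  proof (rule fundamental_lemma)
    show "intgbl a b (\<lambda>t. g t - h t)"
      by (intro set_integral_diff(1) L2_on_integrable assms)
    fix \<phi> assume \<phi>: "test_function a b \<phi>"
    then have "\<phi> \<in> L2_on a b" by (intro L2_on_continuous test_function_continuous)
    then have "intgbl a b (\<lambda>t. g t * \<phi> t)" "intgbl a b (\<lambda>t. h t * \<phi> t)"
      using assms by (auto intro: L2_on_mult_integrable)
    then show "intg a b (\<lambda>t. (g t - h t) * \<phi> t) = 0"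
      using assms(1,2) \<phi> by (simp add: left_diff_distrib is_weak_deriv_def)
  qed
  then show ?thesis by simp
qed

text \<open>The difference of f and the primitive of g has weak derivative zero, hence is constant
  a.e.\<close>

lemma weak_deriv_primitive_AE:
  assumes "f \<in> L2_on a b" "g \<in> L2_on a b" "is_weak_deriv a b f g" "a < b"
  obtains C where "AE t in lborel. t \<in> {a<..<b} \<longrightarrow> f t = C + intg a t g"
proof -
  define G where "G t = intg a t g" for t
  have G: "is_primitive a b G g" using assms by (simp add: is_primitive_def G_def)
  have GL: "G \<in> L2_on a b" using is_primitive_continuous[OF G] by (rule L2_on_continuous)
  obtain C where "AE t in lborel. t \<in> {a<..<b} \<longrightarrow> f t + (- 1) * G t = C"
  proof (rule constant_AE_of_weak_deriv_zero[OF L2_on_add[OF assms(1) L2_on_cmult[OF GL, of "- 1"]] \<open>a < b\<close>])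
    fix \<phi> assume \<phi>: "test_function a b \<phi>"
    then have "deriv \<phi> \<in> L2_on a b" by (intro L2_on_continuous test_function_continuous)
    then have "intgbl a b (\<lambda>t. f t * deriv \<phi> t)" "intgbl a b (\<lambda>t. G t * deriv \<phi> t)"
      using assms GL by (auto intro: L2_on_mult_integrable)
    then show "intg a b (\<lambda>t. (f t + (- 1) * G t) * deriv \<phi> t) = 0"
      using assms(3) is_primitive_weak_deriv[OF G] \<phi> \<open>a < b\<close>
      by (simp add: left_diff_distrib is_weak_deriv_def)
  qed blast
  then show thesis by (intro that[of C]) (auto simp: G_def)
qed

text \<open>The coincidence set is closed and has full measure in (a, b); a closed set of full
  measure in an open set contains it, and closing up adds the end points.\<close>

lemma continuous_AE_eq:
  fixes f h :: "real \<Rightarrow> real"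
  assumes "continuous_on {a..b} f" "continuous_on {a..b} h" "a < b"
    and "AE t in lborel. t \<in> {a<..<b} \<longrightarrow> f t = h t" and t: "t \<in> {a..b}"
  shows "f t = h t"
proof -
  define C where "C = {t \<in> {a..b}. f t = h t}"
  have "closed {t \<in> {a..b}. f t - h t = 0}"
    using assms by (intro continuous_closed_preimage_constant continuous_intros) auto
  then have C: "closed C" by (simp add: C_def)
  have "AE t in lborel. t \<in> {a<..<b} \<longrightarrow> t \<in> C"
    using assms(4) by eventually_elim (auto simp: C_def)
  then have "AE t in lebesgue. t \<in> {a<..<b} \<longrightarrow> t \<in> C" by (rule AE_completion)
  then have "{a<..<b} \<subseteq> C"
    using mem_closed_if_AE_lebesgue_open[OF open_greaterThanLessThan C] by blast
  then have "closure {a<..<b} \<subseteq> C" using C by (rule closure_minimal)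
  then show ?thesis using t \<open>a < b\<close> by (auto simp: C_def)
qed

lemma is_primitive_of_W21:
  assumes "f \<in> W21 a b" "g \<in> L2_on a b" "is_weak_deriv a b f g" "a < b"
  shows "is_primitive a b f g"
proof -
  have f: "f \<in> L2_on a b" "continuous_on {a..b} f"
    using assms(1) by (auto simp: W21_def W21_class_def)
  obtain C where C: "AE t in lborel. t \<in> {a<..<b} \<longrightarrow> f t = C + intg a t g"
    using weak_deriv_primitive_AE[OF f(1) assms(2-4)] by blast
  have "f t = C + intg a t g" if "t \<in> {a..b}" for t
    using assms f C that
    by (intro continuous_AE_eq[of a b f "\<lambda>t. C + intg a t g"] continuous_intros continuous_on_primitive L2_on_integrable)
  with assms(2) show ?thesis by (rule is_primitiveI)
qed

lemma W21_of_is_primitive: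
  assumes "is_primitive a b f g" "a \<le> b"
  shows "f \<in> W21 a b"
  using is_primitive_continuous[OF assms(1)] is_primitive_weak_deriv[OF assms] is_primitive_L2[OF assms(1)]
  by (auto simp: W21_def W21_class_def intro: L2_on_continuous)

lemma weak_deriv_W21_class:
  assumes "f \<in> W21_class a b"
  shows "weak_deriv a b f \<in> L2_on a b" "is_weak_deriv a b f (weak_deriv a b f)"
proof -
  have "\<exists>g. g \<in> L2_on a b \<and> is_weak_deriv a b f g" using assms by (auto simp: W21_class_def)
  then have "weak_deriv a b f \<in> L2_on a b \<and> is_weak_deriv a b f (weak_deriv a b f)"
    unfolding weak_deriv_def by (rule someI_ex)
  then show "weak_deriv a b f \<in> L2_on a b" "is_weak_deriv a b f (weak_deriv a b f)" by auto
qed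

lemma is_primitive_weak_deriv_W21:
  assumes "f \<in> W21 a b" "a < b"
  shows "is_primitive a b f (weak_deriv a b f)"
  using assms weak_deriv_W21_class[of f a b]
  by (intro is_primitive_of_W21) (auto simp: W21_def)

lemma weak_deriv_AE_eq:
  assumes "f \<in> W21_class a b" "g \<in> L2_on a b" "is_weak_deriv a b f g"
  shows "AE t in lborel. t \<in> {a<..<b} \<longrightarrow> weak_deriv a b f t = g t"
  using assms weak_deriv_W21_class by (intro weak_deriv_unique)

lemma is_primitive_AE_unique:
  assumes "is_primitive a b f g" "is_primitive a b f h" "a \<le> b"
  shows "AE t in lborel. t \<in> {a<..<b} \<longrightarrow> g t = h t"
  using assms is_primitive_weak_deriv is_primitive_L2 by (intro weak_deriv_unique) blast+

text \<open>Carries condition (E) over to the derivative: from c on, both g and 0 are derivatives of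
  f, and these are unique up to null sets.\<close>

lemma is_primitive_deriv_zero_AE:
  assumes f: "is_primitive a b f g" and 0: "\<And>t. t \<in> {c..b} \<Longrightarrow> f t = 0" and "a \<le> c" "c \<le> b"
  shows "AE t in lborel. t \<in> {c<..<b} \<longrightarrow> g t = 0"
proof -
  have "is_primitive c b f g"
  proof (rule is_primitiveI)
    show "g \<in> L2_on c b" using L2_on_subset is_primitive_L2[OF f] \<open>a \<le> c\<close> by blast
    fix t assume t: "t \<in> {c..b}"
    have "intgbl a t g"
      using t by (intro is_primitive_integrable[OF f]) auto
    then have "intg a t g = intg a c g + intg c t g"
      using t assms by (intro intg_split) auto
    then show "f t = (f a + intg a c g) + intg c t g"
      using is_primitive_eq[OF f, of t] t assms by simp
  qed
  moreover have "is_primitive c b f (\<lambda>_. 0)"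
    by (rule is_primitive_cong[OF is_primitive_zero]) (use assms in auto)
  ultimately show ?thesis using \<open>c \<le> b\<close> by (intro is_primitive_AE_unique)
qed

text \<open>The choice in \<open>cont_rep\<close> is harmless: a primitive of g qualifies, and every
  continuous function equal to f a.e. coincides with it on the closed interval. This gives the point
  values in the Kirchhoff condition their meaning.\<close>

lemma cont_rep_is_primitive:
  assumes "f \<in> W21_class a b" "g \<in> L2_on a b" "is_weak_deriv a b f g" "a < b"
  shows "is_primitive a b (cont_rep a b f) g"
    and "AE t in lborel. t \<in> {a<..<b} \<longrightarrow> cont_rep a b f t = f t"
proof -
  have f: "f \<in> L2_on a b" using assms(1) by (auto simp: W21_class_def)
  obtain C where C: "AE t in lborel. t \<in> {a<..<b} \<longrightarrow> f t = C + intg a t g"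
    using weak_deriv_primitive_AE[OF f assms(2-4)] by blast
  have cont: "continuous_on {a..b} (\<lambda>t. C + intg a t g)"
    using assms by (intro continuous_intros continuous_on_primitive L2_on_integrable)
  have "\<exists>h. continuous_on {a..b} h \<and> (AE t\<in>{a<..<b} in lborel. h t = f t)"
    using cont C by (intro exI[of _ "\<lambda>t. C + intg a t g"]) auto
  then have r: "continuous_on {a..b} (cont_rep a b f) \<and> (AE t\<in>{a<..<b} in lborel. cont_rep a b f t = f t)"
    unfolding cont_rep_def by (rule someI_ex)
  then show AE: "AE t in lborel. t \<in> {a<..<b} \<longrightarrow> cont_rep a b f t = f t" by blast
  from AE C have "AE t in lborel. t \<in> {a<..<b} \<longrightarrow> cont_rep a b f t = C + intg a t g"
    by eventually_elim auto
  with r cont have *: "cont_rep a b f t = C + intg a t g" if "t \<in> {a..b}" for t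
    using that \<open>a < b\<close> by (intro continuous_AE_eq[of a b "cont_rep a b f" "\<lambda>t. C + intg a t g"]) auto
  with assms(2) show "is_primitive a b (cont_rep a b f) g" by (rule is_primitiveI)
qed

lemma is_weak_deriv_cong_AE:
  assumes "is_weak_deriv a b f g" "AE t in lborel. t \<in> {a<..<b} \<longrightarrow> g t = h t"
    "g \<in> L2_on a b" "h \<in> L2_on a b"
  shows "is_weak_deriv a b f h"
  unfolding is_weak_deriv_def
proof (intro allI impI)
  fix \<phi> assume \<phi>: "test_function a b \<phi>"
  then have L2: "\<phi> \<in> L2_on a b" by (intro L2_on_continuous test_function_continuous)
  have "intg a b (\<lambda>t. g t * \<phi> t) = intg a b (\<lambda>t. h t * \<phi> t)"
    using assms(2-4) L2 by (intro intg_cong_AE L2_on_mult_integrable) auto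
  then show "intg a b (\<lambda>t. f t * deriv \<phi> t) = - intg a b (\<lambda>t. h t * \<phi> t)"
    using assms(1) \<phi> by (simp add: is_weak_deriv_def)
qed

section \<open>Auxiliary integrals, test profiles and a quadratic inequality\<close>

lemma intg_sum:
  assumes "finite S" "\<And>i. i \<in> S \<Longrightarrow> intgbl a b (f i)"
  shows "intg a b (\<lambda>t. \<Sum>i\<in>S. f i t) = (\<Sum>i\<in>S. intg a b (f i))"
proof -
  have "intg a b (\<lambda>t. \<Sum>i\<in>S. f i t) = (\<integral>t. (\<Sum>i\<in>S. indicator {a<..<b} t *\<^sub>R f i t) \<partial>lborel)"
    by (simp add: set_lebesgue_integral_def sum_distrib_left)
  also have "\<dots> = (\<Sum>i\<in>S. intg a b (f i))"
    unfolding set_lebesgue_integral_def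
    by (rule Bochner_Integration.integral_sum) (use assms in \<open>auto simp: set_integrable_def\<close>)
  finally show ?thesis .
qed

lemma L2_on_affine_sub:
  assumes "f \<in> L2_on A B" "0 < d" "A \<le> s + d * C" "s + d * D \<le> B"
  shows "(\<lambda>t. f (s + d * t)) \<in> L2_on C D"
proof (rule L2_on_subset[OF L2_on_affine[OF assms(1,2)]])
  show "(A - s) / d \<le> C" "D \<le> (B - s) / d" using assms(2-4) by (auto simp: field_simps)
qed

text \<open>Profile on the outgoing edges for isolating the Kirchhoff defect: value 1 at the vertex
  and 0 from d on, as (C) and (E) demand when d = l_j.\<close>

lemma is_primitive_tent:
  assumes "0 < d"
  shows "is_primitive 0 B (\<lambda>t. max 0 (1 - t / d)) (\<lambda>t. if t < d then - 1 / d else 0)"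
proof (cases "d \<le> B")
  case True
  let ?g = "\<lambda>t. if t < d then - 1 / d else 0 :: real"
  have g: "?g \<in> L2_on u v" if "v \<le> d \<or> d \<le> u" for u v
    using that by (intro L2_on_cong[OF _ L2_on_const[of "if v \<le> d then - 1 / d else 0"]]) auto
  have gB: "?g \<in> L2_on 0 B"
    by (rule L2_on_glue[of _ 0 d B]) (use g assms True in auto)
  have const: "intg u v ?g = (v - u) * k" if "u \<le> v" "\<And>t. t \<in> {u<..<v} \<Longrightarrow> ?g t = k" for u v k
  proof -
    have "intg u v ?g = intg u v (\<lambda>_. k)" by (rule intg_cong) (rule that)
    then show ?thesis using that(1) by (simp add: set_integral_const)
  qed
  show ?thesis
  proof (rule is_primitiveI[OF gB, of _ 1])
    fix t assume t: "t \<in> {0..B}"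
    show "max 0 (1 - t / d) = 1 + intg 0 t ?g"
    proof (cases "t \<le> d")
      case True
      then have "intg 0 t ?g = (t - 0) * (- 1 / d)" using t by (intro const) auto
      then show ?thesis using True assms by (auto simp: max_def field_simps)
    next
      case False
      have "intgbl 0 t ?g" using t by (intro L2_on_integrable L2_on_subset[OF gB]) auto
      then have "intg 0 t ?g = intg 0 d ?g + intg d t ?g"
        using False assms by (intro intg_split) auto
      also have "intg 0 d ?g = (d - 0) * (- 1 / d)" using assms by (intro const) auto
      also have "intg d t ?g = (t - d) * 0" using False by (intro const) auto
      finally show ?thesis using False assms by (auto simp: max_def field_simps)
    qed
  qed
next
  case False
  \<comment> \<open>The kink lies beyond the interval here, so the derivative is constant on
    it.\<close>
  then have 1: "(\<lambda>t. if t < d then - 1 / d else 0) \<in> L2_on 0 B"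
    by (intro L2_on_cong[OF _ L2_on_const[of "- 1 / d"]]) auto
  show ?thesis
  proof (rule is_primitiveI[OF 1, of _ 1])
    fix t assume t: "t \<in> {0..B}"
    have "intg 0 t (\<lambda>t. if t < d then - 1 / d else 0) = intg 0 t (\<lambda>_. - 1 / d)"
      by (rule intg_cong) (use t False in auto)
    then show "max 0 (1 - t / d) = 1 + intg 0 t (\<lambda>t. if t < d then - 1 / d else 0)"
      using t False assms by (auto simp: set_integral_const max_def field_simps)
  qed
qed

text \<open>Companion of the tents on the first edge: with d = B = T_1 it rises from 0 at the start,
  as (I) with y_0 = 0 demands, to 1 at the vertex.\<close>

lemma is_primitive_linear: "is_primitive 0 B (\<lambda>t. t / d) (\<lambda>_. 1 / d)"
  by (rule is_primitiveI[where C = 0]) (simp_all add: L2_on_const set_integral_const)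

lemma quadratic_nonneg_imp_linear_zero:
  fixes B C :: real
  assumes "\<And>r. 0 \<le> 2 * r * B + r\<^sup>2 * C"
  shows "B = 0"
proof (rule ccontr)
  assume B: "B \<noteq> 0"
  \<comment> \<open>A positive upper bound for C: the vertex -B/C of the parabola is of no use when
    C <= 0, whereas r = -B/D bounds the polynomial by -B^2/D for every C.\<close>
  define D where "D = \<bar>C\<bar> + 1"
  have D: "D > 0" "C \<le> D" by (auto simp: D_def)
  have "0 \<le> 2 * (- B / D) * B + (- B / D)\<^sup>2 * C" by (rule assms)
  also have "\<dots> \<le> 2 * (- B / D) * B + (- B / D)\<^sup>2 * D"
    using D by (intro add_left_mono mult_left_mono) auto
  also have "\<dots> = - (B\<^sup>2 / D)" using D by (simp add: power2_eq_square field_simps)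
  finally show False using B D by (simp add: divide_le_0_iff)
qed

subsection \<open>The star graph\<close>

locale star_graph =
  fixes m :: nat and q :: real and T \<alpha> a b c :: "nat \<Rightarrow> real"
  assumes m_ge_2: "m \<ge> 2" and q_gt_1: "q > 1" and T1_pos: "T 1 > 0"
    and T_gt: "\<And>j. j \<in> {2..m} \<Longrightarrow> T j > (q - 1) * T 1"
    and \<alpha>_pos: "\<And>j. j \<in> {1..m} \<Longrightarrow> \<alpha> j > 0"
begin

declare One_nat_def [simp del]

abbreviation l :: "nat \<Rightarrow> real" where "l \<equiv> len q T"

definition arg :: "nat \<Rightarrow> real \<Rightarrow> real" where
  "arg j t = (if j = 1 then t / q else (t - (q - 1) * T 1) / q)"

text \<open>The derivative is a separate argument because \<^const>\<open>graph_deriv\<close>, being chosen by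
  \<open>SOME\<close>, is linear only up to null sets, whereas \<open>ellD\<close> is linear pointwise.\<close>

definition ellD :: "(nat \<Rightarrow> real \<Rightarrow> real) \<Rightarrow> (nat \<Rightarrow> real \<Rightarrow> real) \<Rightarrow> nat \<Rightarrow> real \<Rightarrow> real" where
  "ellD dy y j t = dy j t + a j * delay_ext T dy j (arg j t) + b j * y j t + c j * delay_ext T y j (arg j t)"

text \<open>\<^const>\<open>ell_tilde\<close> with \<open>ell y\<close> replaced by an arbitrary \<open>L\<close>: the adjoint of the delay operator
  (see \<open>adj_delay\<close>).\<close>

definition adj :: "(nat \<Rightarrow> real) \<Rightarrow> (nat \<Rightarrow> real \<Rightarrow> real) \<Rightarrow> nat \<Rightarrow> real \<Rightarrow> real" where
  "adj \<theta> L j t =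
     (if j = 1 then
        (if t < T 1 / q then q * \<alpha> 1 * \<theta> 1 * L 1 (q * t)
         else q * (\<Sum>k=2..m. \<alpha> k * \<theta> k * L k (q * t - T 1)))
      else
        (if t < l j then q * \<alpha> j * \<theta> j * L j (q * t + (q - 1) * T 1) else 0))"

definition L2_graph :: "(nat \<Rightarrow> real \<Rightarrow> real) \<Rightarrow> bool" where
  "L2_graph v \<longleftrightarrow> (\<forall>j\<in>{1..m}. v j \<in> L2_on 0 (T j))"

definition graph_primitive :: "(nat \<Rightarrow> real \<Rightarrow> real) \<Rightarrow> (nat \<Rightarrow> real \<Rightarrow> real) \<Rightarrow> bool" where
  "graph_primitive y dy \<longleftrightarrow> (\<forall>j\<in>{1..m}. is_primitive 0 (T j) (y j) (dy j))"

text \<open>The weighted L_2 inner product on the graph. Its diagonal at \<open>ell y\<close> is the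
  cost; its mixed value at \<open>ell y\<close> and \<open>ell h\<close> is half the first
  variation.\<close>

definition bilin :: "(nat \<Rightarrow> real \<Rightarrow> real) \<Rightarrow> (nat \<Rightarrow> real \<Rightarrow> real) \<Rightarrow> real" where
  "bilin L M = (\<Sum>j=1..m. \<alpha> j * intg 0 (T j) (\<lambda>t. L j t * M j t))"

text \<open>\<open>flux\<close> and \<open>source\<close> are the coefficients p_j of h_j' and r_j
  of h_j in the transformed first variation; when L is \<open>ell y\<close>, the former is
  \<open>ell_hat\<close>.\<close>

definition flux :: "(nat \<Rightarrow> real \<Rightarrow> real) \<Rightarrow> nat \<Rightarrow> real \<Rightarrow> real" where
  "flux L j t = \<alpha> j * L j t + adj a L j t"

definition source :: "(nat \<Rightarrow> real \<Rightarrow> real) \<Rightarrow> nat \<Rightarrow> real \<Rightarrow> real" where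
  "source L j t = \<alpha> j * b j * L j t + adj c L j t"

lemma ell_eq_ellD: "ell q T a b c y = ellD (graph_deriv T y) y"
  by (intro ext) (simp add: ell_def ellD_def arg_def Let_def)

lemma ell_hat_eq_flux: "ell_hat m q T \<alpha> a b c y = flux (ell q T a b c y)"
  by (intro ext) (simp add: ell_hat_def flux_def ell_tilde_def adj_def)

lemma bvp_operator_eq:
  "bvp_operator m q T \<alpha> a b c y j t =
    - weak_deriv 0 (l j) (flux (ell q T a b c y) j) t + source (ell q T a b c y) j t"
  by (simp add: bvp_operator_def ell_hat_eq_flux source_def ell_tilde_def adj_def)

lemma cost_eq_bilin: "cost m q T \<alpha> a b c y = bilin (ell q T a b c y) (ell q T a b c y)"
  by (simp add: cost_def bilin_def power2_eq_square)

section \<open>Edge lengths and delayed arguments\<close>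

lemma q_pos: "q > 0" using q_gt_1 by simp

lemma delay_pos: "0 < (q - 1) * T 1" using q_gt_1 T1_pos by simp

lemma T_pos: "j \<in> {1..m} \<Longrightarrow> T j > 0"
  using T_gt[of j] T1_pos delay_pos by (cases "j = 1") auto

lemma len_1: "l 1 = T 1" by (simp add: len_def)

lemma len_eq: "j \<noteq> 1 \<Longrightarrow> q * l j + (q - 1) * T 1 = T j"
  using q_pos by (simp add: len_def)

lemma len_pos: "j \<in> {1..m} \<Longrightarrow> 0 < l j"
  using T_gt[of j] T1_pos q_pos by (auto simp: len_def)

lemma len_le: "j \<in> {1..m} \<Longrightarrow> l j \<le> T j"
proof (cases "j = 1")
  case False
  assume j: "j \<in> {1..m}"
  have "1 * l j \<le> q * l j" using len_pos[OF j] q_gt_1 by (intro mult_right_mono) auto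
  then show ?thesis using len_eq[OF False] delay_pos by simp
qed (simp add: len_1)

lemma T1_div_q: "0 < T 1 / q" "T 1 / q < T 1"
  using T1_pos q_gt_1 by (auto simp: field_simps)

text \<open>The form c + d t is the one in which the affine substitution lemmas are stated.\<close>

lemma arg_1: "arg 1 t = 0 + (1 / q) * t"
  by (simp add: arg_def)

lemma arg_other:
  assumes "j \<noteq> 1"
  shows "arg j t = - ((q - 1) * T 1 / q) + (1 / q) * t" "arg j t + T 1 = T 1 / q + (1 / q) * t"
    "arg j t < 0 \<longleftrightarrow> t < (q - 1) * T 1"
  using assms q_pos by (auto simp: arg_def field_simps)

text \<open>Before (q - 1) T_1 the delayed argument is negative and the extension reads edge 1. As t
  runs over (0, (q - 1) T_1), the point read runs over (T_1/q, T_1), which explains the breakpoint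
  T_1/q in \<open>adj\<close>.\<close>

lemma delay_ext_early:
  assumes "j \<noteq> 1" "t < (q - 1) * T 1"
  shows "delay_ext T v j (arg j t) = v 1 (T 1 / q + (1 / q) * t)"
proof -
  have "delay_ext T v j (arg j t) = v 1 (arg j t + T 1)"
    unfolding delay_ext_def using assms arg_other(3)[OF assms(1)] by simp
  then show ?thesis by (simp only: arg_other(2)[OF assms(1)])
qed

lemma delay_ext_late:
  assumes "j \<noteq> 1" "\<not> t < (q - 1) * T 1"
  shows "delay_ext T v j (arg j t) = v j (- ((q - 1) * T 1 / q) + (1 / q) * t)"
proof -
  have "delay_ext T v j (arg j t) = v j (arg j t)"
    unfolding delay_ext_def using assms arg_other(3)[OF assms(1)] by simp
  then show ?thesis by (simp only: arg_other(1)[OF assms(1)])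
qed

section \<open>Square integrability and null sets under the delay\<close>

lemma L2_graphD: "L2_graph v \<Longrightarrow> j \<in> {1..m} \<Longrightarrow> v j \<in> L2_on 0 (T j)"
  by (simp add: L2_graph_def)

lemma L2_graph_mult:
  "L2_graph u \<Longrightarrow> L2_graph v \<Longrightarrow> j \<in> {1..m} \<Longrightarrow> intgbl 0 (T j) (\<lambda>t. u j t * v j t)"
  by (intro L2_on_mult_integrable L2_graphD)

lemma one_in: "1 \<in> {1..m}" using m_ge_2 by simp

lemma in_2: "j \<in> {2..m} \<Longrightarrow> j \<in> {1..m}" "j \<in> {2..m} \<Longrightarrow> j \<noteq> 1" by auto

lemma sum_split_1: "(\<Sum>j=1..m. f j) = f 1 + (\<Sum>j=2..m. f j)" for f :: "nat \<Rightarrow> real"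
  using m_ge_2 by (simp add: sum.atLeast_Suc_atMost numeral_2_eq_2)

lemma L2_graph_delay:
  assumes v: "L2_graph v" and j: "j \<in> {1..m}"
  shows "(\<lambda>t. delay_ext T v j (arg j t)) \<in> L2_on 0 (T j)"
proof (cases "j = 1")
  case True
  have "(\<lambda>t. v 1 (0 + (1 / q) * t)) \<in> L2_on 0 (T 1)"
    using q_pos T1_div_q by (intro L2_on_affine_sub[OF L2_graphD[OF v one_in]]) auto
  then show ?thesis using True by (simp add: delay_ext_def arg_1)
next
  case False
  let ?D = "(q - 1) * T 1"
  have "(\<lambda>t. v 1 (T 1 / q + (1 / q) * t)) \<in> L2_on 0 ?D"
    using q_pos T1_div_q by (intro L2_on_affine_sub[OF L2_graphD[OF v one_in]]) (auto simp: field_simps)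
  then have 1: "(\<lambda>t. delay_ext T v j (arg j t)) \<in> L2_on 0 ?D"
    by (rule L2_on_cong[rotated]) (simp add: delay_ext_early[OF False])
  have "(\<lambda>t. v j (- (?D / q) + (1 / q) * t)) \<in> L2_on ?D (T j)"
  proof (rule L2_on_affine_sub[OF L2_graphD[OF v j]])
    \<comment> \<open>The last point read on edge j is l_j, so the delayed argument stays on the
      edge.\<close>
    have "- (?D / q) + 1 / q * T j = l j" using False by (simp add: len_def diff_divide_distrib)
    then show "- (?D / q) + 1 / q * T j \<le> T j" using len_le[OF j] by simp
  qed (use q_pos in auto)
  then have 2: "(\<lambda>t. delay_ext T v j (arg j t)) \<in> L2_on ?D (T j)"
    by (rule L2_on_cong[rotated]) (simp add: delay_ext_late[OF False])
  have "?D \<le> T j" using T_gt[of j] j False by auto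
  with 1 2 delay_pos show ?thesis by (intro L2_on_glue[OF 1 2]) auto
qed

text \<open>Derivatives are fixed only up to null sets; the delay samples them along affine maps,
  which pull null sets back to null sets.\<close>

lemma delay_AE_eq:
  assumes vw: "\<And>j. j \<in> {1..m} \<Longrightarrow> AE t in lborel. t \<in> {0<..<T j} \<longrightarrow> v j t = w j t"
    and j: "j \<in> {1..m}"
  shows "AE t in lborel. t \<in> {0<..<T j} \<longrightarrow> delay_ext T v j (arg j t) = delay_ext T w j (arg j t)"
proof (cases "j = 1")
  case True
  have "AE t in lborel. 0 + 1 / q * t \<in> {0<..<T 1} \<longrightarrow> v 1 (0 + 1 / q * t) = w 1 (0 + 1 / q * t)"
    using q_pos by (intro AE_on_affine vw one_in) auto
  then show ?thesis
  proof eventually_elim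
    case (elim t)
    show ?case
    proof
      assume t: "t \<in> {0<..<T j}"
      have "t / q < t / 1" using t q_gt_1 by (intro divide_strict_left_mono) auto
      then have "0 + 1 / q * t \<in> {0<..<T 1}" using t True q_pos by auto
      with elim True show "delay_ext T v j (arg j t) = delay_ext T w j (arg j t)"
        by (simp add: delay_ext_def arg_1)
    qed
  qed
next
  case False
  let ?D = "(q - 1) * T 1"
  have "AE t in lborel. T 1 / q + 1 / q * t \<in> {0<..<T 1} \<longrightarrow> v 1 (T 1 / q + 1 / q * t) = w 1 (T 1 / q + 1 / q * t)"
    using q_pos by (intro AE_on_affine vw one_in) auto
  moreover have "AE t in lborel. - (?D / q) + 1 / q * t \<in> {0<..<T j} \<longrightarrow>
      v j (- (?D / q) + 1 / q * t) = w j (- (?D / q) + 1 / q * t)"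
    using q_pos by (intro AE_on_affine vw j) auto
  \<comment> \<open>At t = \<open>?D\<close> the delayed argument is 0, an end point about which the
    hypothesis says nothing.\<close>
  moreover note AE_lborel_singleton[of ?D]
  ultimately show ?thesis
  proof eventually_elim
    case (elim t)
    show ?case
    proof
      assume t: "t \<in> {0<..<T j}"
      show "delay_ext T v j (arg j t) = delay_ext T w j (arg j t)"
      proof (cases "t < ?D")
        case True
        have "T 1 / q + 1 / q * t \<in> {0<..<T 1}"
          using t True q_pos T1_pos by (auto simp: field_simps add_pos_pos)
        with elim(1) show ?thesis by (simp only: delay_ext_early[OF False True])
      next
        case ge: False
        have "- (?D / q) + 1 / q * t < - (?D / q) + 1 / q * T j"
          using t q_pos by (auto simp: divide_strict_right_mono)
        also have "- (?D / q) + 1 / q * T j = l j" using False by (simp add: len_def diff_divide_distrib)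
        also note len_le[OF j]
        finally have "- (?D / q) + 1 / q * t \<in> {0<..<T j}"
          using ge elim(3) q_pos by (auto simp: divide_strict_right_mono)
        with elim(2) show ?thesis by (simp only: delay_ext_late[OF False ge])
      qed
    qed
  qed
qed

lemma L2_graph_ellD:
  assumes "L2_graph dy" "L2_graph y"
  shows "L2_graph (ellD dy y)"
  unfolding L2_graph_def ellD_def[abs_def]
  using assms by (auto intro!: L2_on_add L2_on_cmult L2_graph_delay simp: L2_graphD)

lemma ellD_AE_eq:
  assumes "\<And>j. j \<in> {1..m} \<Longrightarrow> AE t in lborel. t \<in> {0<..<T j} \<longrightarrow> v j t = w j t" and j: "j \<in> {1..m}"
  shows "AE t in lborel. t \<in> {0<..<T j} \<longrightarrow> ellD v y j t = ellD w y j t"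
proof -
  have "AE t in lborel. t \<in> {0<..<T j} \<longrightarrow> delay_ext T v j (arg j t) = delay_ext T w j (arg j t)"
    by (rule delay_AE_eq) (use assms in auto)
  with assms(1)[OF j] show ?thesis by eventually_elim (auto simp: ellD_def)
qed

lemma ellD_linear:
  "ellD (\<lambda>j t. dy j t + r * dh j t) (\<lambda>j t. y j t + r * h j t) j t = ellD dy y j t + r * ellD dh h j t"
  by (simp add: ellD_def delay_ext_def algebra_simps)

section \<open>The adjoint of the delay\<close>

lemma L2_first_edge:
  assumes "L2_graph L"
  shows "(\<lambda>t. L 1 (q * t)) \<in> L2_on 0 (T 1 / q)"
  using L2_on_affine_sub[OF L2_graphD[OF assms one_in] q_pos, of 0 0 "T 1 / q"] q_pos by simp

lemma L2_shift_back:
  assumes "L2_graph L" "k \<in> {2..m}"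
  shows "(\<lambda>t. L k (q * t - T 1)) \<in> L2_on (T 1 / q) (T 1)"
  using L2_on_affine_sub[OF L2_graphD[OF assms(1) in_2(1)[OF assms(2)]] q_pos, of "- T 1" "T 1 / q" "T 1"]
    T_gt[OF assms(2)] q_pos by (simp add: algebra_simps)

lemma L2_shift:
  assumes "L2_graph L" "k \<in> {2..m}"
  shows "(\<lambda>t. L k (q * t + (q - 1) * T 1)) \<in> L2_on 0 (l k)"
  using L2_on_affine_sub[OF L2_graphD[OF assms(1) in_2(1)[OF assms(2)]] q_pos, of "(q - 1) * T 1" 0 "l k"]
    delay_pos len_eq[OF in_2(2)[OF assms(2)]] by (simp add: add.commute)

lemma L2_adj:
  assumes L: "L2_graph L" and j: "j \<in> {1..m}"
  shows "adj \<theta> L j \<in> L2_on 0 (l j)"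
proof (cases "j = 1")
  case True
  have "(\<lambda>t. q * \<alpha> 1 * \<theta> 1 * L 1 (q * t)) \<in> L2_on 0 (T 1 / q)"
    by (rule L2_on_cmult[OF L2_first_edge[OF L]])
  then have "adj \<theta> L 1 \<in> L2_on 0 (T 1 / q)"
    by (rule L2_on_cong[rotated]) (auto simp: adj_def)
  moreover have "(\<lambda>t. q * (\<Sum>k=2..m. \<alpha> k * \<theta> k * L k (q * t - T 1))) \<in> L2_on (T 1 / q) (T 1)"
    by (intro L2_on_cmult L2_on_sum L2_shift_back L) auto
  then have "adj \<theta> L 1 \<in> L2_on (T 1 / q) (T 1)"
    by (rule L2_on_cong[rotated]) (auto simp: adj_def)
  ultimately have "adj \<theta> L 1 \<in> L2_on 0 (T 1)"
    by (rule L2_on_glue) (use T1_div_q in auto)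
  then show ?thesis using True by (simp add: len_1)
next
  case False
  then have "(\<lambda>t. q * \<alpha> j * \<theta> j * L j (q * t + (q - 1) * T 1)) \<in> L2_on 0 (l j)"
    using j by (intro L2_on_cmult L2_shift L) auto
  then show ?thesis
    by (rule L2_on_cong[rotated]) (use False in \<open>auto simp: adj_def\<close>)
qed

lemma L2_on_len: "L2_graph v \<Longrightarrow> j \<in> {1..m} \<Longrightarrow> v j \<in> L2_on 0 (l j)"
  using L2_on_subset[OF L2_graphD order_refl len_le] by blast

lemma L2_flux: "L2_graph L \<Longrightarrow> j \<in> {1..m} \<Longrightarrow> flux L j \<in> L2_on 0 (l j)"
  unfolding flux_def[abs_def] by (intro L2_on_add L2_on_cmult L2_adj L2_on_len)

lemma L2_source: "L2_graph L \<Longrightarrow> j \<in> {1..m} \<Longrightarrow> source L j \<in> L2_on 0 (l j)"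
  unfolding source_def[abs_def] by (intro L2_on_add L2_on_cmult L2_adj L2_on_len)

lemma delay_integral_1:
  "intg 0 (T 1) (\<lambda>t. L 1 t * delay_ext T v 1 (arg 1 t)) = q * intg 0 (T 1 / q) (\<lambda>s. L 1 (q * s) * v 1 s)"
  using intg_affine[OF q_pos, of 0 "T 1" "\<lambda>t. L 1 t * delay_ext T v 1 (arg 1 t)" 0] q_pos
  by (simp add: delay_ext_def arg_1)

text \<open>Cut at (q - 1) T_1 and substitute separately: t = q s - T_1 brings the early part to
  (T_1/q, T_1) on edge 1, and t = q s + (q - 1) T_1 brings the late part to (0, l_k) on edge
  k.\<close>

lemma delay_integral_other:
  assumes L: "L2_graph L" and v: "L2_graph v" and k: "k \<in> {2..m}"
  shows "intg 0 (T k) (\<lambda>t. L k t * delay_ext T v k (arg k t)) =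
    q * intg (T 1 / q) (T 1) (\<lambda>s. L k (q * s - T 1) * v 1 s)
    + q * intg 0 (l k) (\<lambda>s. L k (q * s + (q - 1) * T 1) * v k s)"
proof -
  let ?F = "\<lambda>t. L k t * delay_ext T v k (arg k t)" and ?D = "(q - 1) * T 1"
  have k1: "k \<noteq> 1" and km: "k \<in> {1..m}" using k by auto
  have "intgbl 0 (T k) ?F"
    by (intro L2_on_mult_integrable L2_graphD L2_graph_delay L v km)
  then have "intg 0 (T k) ?F = intg 0 ?D ?F + intg ?D (T k) ?F"
    using delay_pos T_gt[OF k] by (intro intg_split) auto
  moreover have "intg 0 ?D ?F = q * intg (T 1 / q) (T 1) (\<lambda>s. L k (q * s - T 1) * v 1 s)"
  proof -
    have "intg 0 ?D ?F = q * intg ((0 - (- T 1)) / q) ((?D - (- T 1)) / q) (\<lambda>s. ?F (- T 1 + q * s))"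
      by (rule intg_affine[OF q_pos])
    also have "(0 - (- T 1)) / q = T 1 / q" by simp
    also have "(?D - (- T 1)) / q = T 1" using q_pos by (simp add: field_simps)
    also have "intg (T 1 / q) (T 1) (\<lambda>s. ?F (- T 1 + q * s)) = intg (T 1 / q) (T 1) (\<lambda>s. L k (q * s - T 1) * v 1 s)"
    proof (rule intg_cong)
      fix s assume s: "s \<in> {T 1 / q<..<T 1}"
      have "arg k (- T 1 + q * s) = s - T 1" using k1 q_pos by (simp add: arg_def field_simps)
      then show "?F (- T 1 + q * s) = L k (q * s - T 1) * v 1 s"
        using s k1 by (simp add: delay_ext_def)
    qed
    finally show ?thesis .
  qed
  moreover have "intg ?D (T k) ?F = q * intg 0 (l k) (\<lambda>s. L k (q * s + ?D) * v k s)"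
  proof -
    have "intg ?D (T k) ?F = q * intg ((?D - ?D) / q) ((T k - ?D) / q) (\<lambda>s. ?F (?D + q * s))"
      by (rule intg_affine[OF q_pos])
    also have "(?D - ?D) / q = 0" by simp
    also have "(T k - ?D) / q = l k" using k1 by (simp add: len_def)
    also have "intg 0 (l k) (\<lambda>s. ?F (?D + q * s)) = intg 0 (l k) (\<lambda>s. L k (q * s + ?D) * v k s)"
    proof (rule intg_cong)
      fix s assume s: "s \<in> {0<..<l k}"
      have "arg k (?D + q * s) = s" using k1 q_pos by (simp add: arg_def)
      then show "?F (?D + q * s) = L k (q * s + ?D) * v k s"
        using s k1 by (simp add: delay_ext_def add.commute)
    qed
    finally show ?thesis .
  qed
  ultimately show ?thesis by simp
qed

text \<open>All edges k >= 2 read their early history from the end piece (T_1/q, T_1) of edge 1, so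
  in the transpose this piece collects a sum over k; edge 1 itself reads only (0, T_1/q). Hence the
  two branches of \<open>adj\<close> for j = 1.\<close>

lemma adj_delay:
  assumes L: "L2_graph L" and v: "L2_graph v"
  shows "(\<Sum>j=1..m. \<alpha> j * \<theta> j * intg 0 (T j) (\<lambda>t. L j t * delay_ext T v j (arg j t)))
    = (\<Sum>j=1..m. intg 0 (l j) (\<lambda>t. adj \<theta> L j t * v j t))"
proof -
  let ?A = "\<lambda>k. intg (T 1 / q) (T 1) (\<lambda>s. L k (q * s - T 1) * v 1 s)"
  have v1: "v 1 \<in> L2_on (T 1 / q) (T 1)"
    by (rule L2_on_subset[OF L2_graphD[OF v one_in]]) (use T1_div_q in auto)
  have "intgbl 0 (T 1) (\<lambda>t. adj \<theta> L 1 t * v 1 t)"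
    using L2_adj[OF L one_in] L2_graphD[OF v one_in] by (intro L2_on_mult_integrable) (auto simp: len_1)
  then have "intg 0 (l 1) (\<lambda>t. adj \<theta> L 1 t * v 1 t) =
      intg 0 (T 1 / q) (\<lambda>t. adj \<theta> L 1 t * v 1 t) + intg (T 1 / q) (T 1) (\<lambda>t. adj \<theta> L 1 t * v 1 t)"
    unfolding len_1 using T1_div_q by (intro intg_split) auto
  also have "intg 0 (T 1 / q) (\<lambda>t. adj \<theta> L 1 t * v 1 t)
      = intg 0 (T 1 / q) (\<lambda>t. (q * \<alpha> 1 * \<theta> 1) * (L 1 (q * t) * v 1 t))"
    by (rule intg_cong) (simp add: adj_def)
  also have "\<dots> = \<alpha> 1 * \<theta> 1 * (q * intg 0 (T 1 / q) (\<lambda>t. L 1 (q * t) * v 1 t))"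
    by simp
  also have "q * intg 0 (T 1 / q) (\<lambda>t. L 1 (q * t) * v 1 t)
      = intg 0 (T 1) (\<lambda>t. L 1 t * delay_ext T v 1 (arg 1 t))"
    by (simp only: delay_integral_1)
  also have "intg (T 1 / q) (T 1) (\<lambda>t. adj \<theta> L 1 t * v 1 t)
      = intg (T 1 / q) (T 1) (\<lambda>t. \<Sum>k=2..m. (q * \<alpha> k * \<theta> k) * (L k (q * t - T 1) * v 1 t))"
    by (rule intg_cong) (simp add: adj_def sum_distrib_left sum_distrib_right mult_ac)
  also have "\<dots> = (\<Sum>k=2..m. intg (T 1 / q) (T 1) (\<lambda>t. (q * \<alpha> k * \<theta> k) * (L k (q * t - T 1) * v 1 t)))"
    by (intro intg_sum set_integrable_mult_right L2_on_mult_integrable L2_shift_back L v1) auto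
  also have "\<dots> = (\<Sum>k=2..m. \<alpha> k * \<theta> k * (q * ?A k))"
    by (simp add: mult_ac)
  finally have 1: "intg 0 (l 1) (\<lambda>t. adj \<theta> L 1 t * v 1 t) =
      \<alpha> 1 * \<theta> 1 * intg 0 (T 1) (\<lambda>t. L 1 t * delay_ext T v 1 (arg 1 t)) + (\<Sum>k=2..m. \<alpha> k * \<theta> k * (q * ?A k))" .
  have 2: "intg 0 (l k) (\<lambda>t. adj \<theta> L k t * v k t) =
      \<alpha> k * \<theta> k * (q * intg 0 (l k) (\<lambda>s. L k (q * s + (q - 1) * T 1) * v k s))" if "k \<in> {2..m}" for k
  proof -
    have "intg 0 (l k) (\<lambda>t. adj \<theta> L k t * v k t)
        = intg 0 (l k) (\<lambda>t. (q * \<alpha> k * \<theta> k) * (L k (q * t + (q - 1) * T 1) * v k t))"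
      by (rule intg_cong) (use that in \<open>simp add: adj_def\<close>)
    then show ?thesis by simp
  qed
  have "(\<Sum>k=2..m. \<alpha> k * \<theta> k * intg 0 (T k) (\<lambda>t. L k t * delay_ext T v k (arg k t)))
    = (\<Sum>k=2..m. \<alpha> k * \<theta> k * (q * ?A k)) + (\<Sum>k=2..m. intg 0 (l k) (\<lambda>t. adj \<theta> L k t * v k t))"
    unfolding sum.distrib[symmetric]
    by (rule sum.cong) (simp_all only: delay_integral_other[OF L v] 2 distrib_left)
  then show ?thesis unfolding sum_split_1 1 by simp
qed

section \<open>The cost as a quadratic form\<close>

lemma graph_primitiveD: "graph_primitive y dy \<Longrightarrow> j \<in> {1..m} \<Longrightarrow> is_primitive 0 (T j) (y j) (dy j)"
  by (simp add: graph_primitive_def)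

lemma graph_primitive_L2:
  assumes "graph_primitive y dy"
  shows "L2_graph dy" "L2_graph y" "L2_graph (ellD dy y)"
proof -
  show "L2_graph dy" "L2_graph y"
    using assms by (auto simp: L2_graph_def graph_primitive_def
        intro: is_primitive_L2 L2_on_continuous is_primitive_continuous)
  then show "L2_graph (ellD dy y)" by (rule L2_graph_ellD)
qed

lemma graph_primitive_graph_deriv: "y \<in> W21_graph m T \<Longrightarrow> graph_primitive y (graph_deriv T y)"
  unfolding graph_primitive_def graph_deriv_def W21_graph_def
  using T_pos is_primitive_weak_deriv_W21 by blast

lemma W21_graph_of_graph_primitive:
  assumes "graph_primitive y dy"
  shows "y \<in> W21_graph m T"
  unfolding W21_graph_def
  using W21_of_is_primitive[OF graph_primitiveD[OF assms]] T_pos by (auto simp: less_imp_le)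

lemma bilin_cong_AE:
  assumes "\<And>j. j \<in> {1..m} \<Longrightarrow> AE t in lborel. t \<in> {0<..<T j} \<longrightarrow> L j t = L' j t"
    "\<And>j. j \<in> {1..m} \<Longrightarrow> AE t in lborel. t \<in> {0<..<T j} \<longrightarrow> M j t = M' j t"
    "L2_graph L" "L2_graph L'" "L2_graph M" "L2_graph M'"
  shows "bilin L M = bilin L' M'"
  unfolding bilin_def
proof (intro sum.cong refl arg_cong[where f = "(*) _"] intg_cong_AE)
  fix j assume j: "j \<in> {1..m}"
  show "AE t in lborel. t \<in> {0<..<T j} \<longrightarrow> L j t * M j t = L' j t * M' j t"
    using assms(1,2)[OF j] by eventually_elim auto
  show "intgbl 0 (T j) (\<lambda>t. L j t * M j t)" "intgbl 0 (T j) (\<lambda>t. L' j t * M' j t)"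
    using assms(3-6) j by (auto intro!: L2_graph_mult)
qed

lemma bilin_expand:
  assumes "L2_graph L" "L2_graph M"
  shows "bilin (\<lambda>j t. L j t + r * M j t) (\<lambda>j t. L j t + r * M j t)
    = bilin L L + 2 * r * bilin L M + r\<^sup>2 * bilin M M"
proof -
  have "intg 0 (T j) (\<lambda>t. (L j t + r * M j t) * (L j t + r * M j t))
      = intg 0 (T j) (\<lambda>t. L j t * L j t) + (2 * r) * intg 0 (T j) (\<lambda>t. L j t * M j t)
        + r\<^sup>2 * intg 0 (T j) (\<lambda>t. M j t * M j t)" if "j \<in> {1..m}" for j
  proof -
    have i: "intgbl 0 (T j) (\<lambda>t. L j t * L j t)" "intgbl 0 (T j) (\<lambda>t. L j t * M j t)"
      "intgbl 0 (T j) (\<lambda>t. M j t * M j t)"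
      by (intro L2_graph_mult assms that)+
    have "intg 0 (T j) (\<lambda>t. (L j t + r * M j t) * (L j t + r * M j t))
      = intg 0 (T j) (\<lambda>t. L j t * L j t + (2 * r) * (L j t * M j t) + r\<^sup>2 * (M j t * M j t))"
      by (rule intg_cong) (simp add: algebra_simps power2_eq_square)
    also have "\<dots> = intg 0 (T j) (\<lambda>t. L j t * L j t + (2 * r) * (L j t * M j t))
        + intg 0 (T j) (\<lambda>t. r\<^sup>2 * (M j t * M j t))"
      by (intro set_integral_add set_integrable_mult_right i)
    also have "intg 0 (T j) (\<lambda>t. L j t * L j t + (2 * r) * (L j t * M j t))
        = intg 0 (T j) (\<lambda>t. L j t * L j t) + intg 0 (T j) (\<lambda>t. (2 * r) * (L j t * M j t))"
      by (intro set_integral_add set_integrable_mult_right i)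
    finally show ?thesis by simp
  qed
  then show ?thesis
    by (simp add: bilin_def sum.distrib sum_distrib_left algebra_simps)
qed

lemma bilin_nonneg: "0 \<le> bilin L L"
  unfolding bilin_def set_lebesgue_integral_def
  by (intro sum_nonneg mult_nonneg_nonneg Bochner_Integration.integral_nonneg)
    (use \<alpha>_pos in \<open>auto intro: less_imp_le\<close>)

text \<open>Any derivative dy may stand in for the chosen \<open>graph_deriv\<close>: the two agree
  a.e., hence so do the resulting \<open>ellD\<close>. Along y + r h one can then take dy + r dh,
  for which linearity is pointwise.\<close>

lemma cost_graph_primitive:
  assumes "graph_primitive y dy"
  shows "cost m q T \<alpha> a b c y = bilin (ellD dy y) (ellD dy y)"
proof -
  have y: "y \<in> W21_graph m T" using assms by (rule W21_graph_of_graph_primitive)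
  have "AE t in lborel. t \<in> {0<..<T j} \<longrightarrow> graph_deriv T y j t = dy j t" if "j \<in> {1..m}" for j
    using T_pos[OF that]
    by (intro is_primitive_AE_unique[OF graph_primitiveD[OF graph_primitive_graph_deriv[OF y] that]
          graph_primitiveD[OF assms that]]) auto
  then have "AE t in lborel. t \<in> {0<..<T j} \<longrightarrow> ellD (graph_deriv T y) y j t = ellD dy y j t" if "j \<in> {1..m}" for j
    by (rule ellD_AE_eq) (use that in auto)
  then show ?thesis unfolding cost_eq_bilin ell_eq_ellD
    using graph_primitive_L2(3)[OF assms] graph_primitive_L2(3)[OF graph_primitive_graph_deriv[OF y]]
    by (intro bilin_cong_AE)
qed

lemma graph_primitive_linear:
  assumes "graph_primitive y dy" "graph_primitive h dh"
  shows "graph_primitive (\<lambda>j t. y j t + r * h j t) (\<lambda>j t. dy j t + r * dh j t)"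
  using assms by (auto simp: graph_primitive_def intro!: is_primitive_add is_primitive_cmult)

lemma cost_linear:
  assumes "graph_primitive y dy" "graph_primitive h dh"
  shows "cost m q T \<alpha> a b c (\<lambda>j t. y j t + r * h j t) =
    bilin (ellD dy y) (ellD dy y) + 2 * r * bilin (ellD dy y) (ellD dh h) + r\<^sup>2 * bilin (ellD dh h) (ellD dh h)"
  unfolding cost_graph_primitive[OF graph_primitive_linear[OF assms]] ellD_linear[abs_def]
  using assms by (intro bilin_expand graph_primitive_L2)

text \<open>Differences of admissible functions satisfy (I) with y_0 = 0, which fixes the space of
  directions. Minimality at r = 0 kills the linear coefficient of the cost along y + r h; conversely
  any competitor is y + h, where the linear term is absent and the quadratic one is
  nonnegative.\<close>

lemma variational_iff_stationary:
  assumes y: "y \<in> W21_graph m T"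
  shows "variational_solution m q T \<alpha> a b c y0 y \<longleftrightarrow> admissible m q T y0 y \<and>
    (\<forall>h dh. graph_primitive h dh \<longrightarrow> admissible m q T 0 h \<longrightarrow> bilin (ell q T a b c y) (ellD dh h) = 0)"
    (is "?V \<longleftrightarrow> ?A \<and> ?S")
proof
  let ?dy = "graph_deriv T y"
  have py: "graph_primitive y ?dy" using y by (rule graph_primitive_graph_deriv)
  {
    assume V: ?V
    then have A: ?A by (simp add: variational_solution_def)
    have "bilin (ellD ?dy y) (ellD dh h) = 0" if h: "graph_primitive h dh" "admissible m q T 0 h" for h dh
    proof (rule quadratic_nonneg_imp_linear_zero)
      fix r
      have "(\<lambda>j t. y j t + r * h j t) \<in> W21_graph m T"
        using graph_primitive_linear[OF py h(1)] by (rule W21_graph_of_graph_primitive)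
      moreover have "admissible m q T y0 (\<lambda>j t. y j t + r * h j t)"
        using A h(2) by (simp add: admissible_def)
      ultimately have "cost m q T \<alpha> a b c y \<le> cost m q T \<alpha> a b c (\<lambda>j t. y j t + r * h j t)"
        using V by (simp add: variational_solution_def)
      then show "0 \<le> 2 * r * bilin (ellD ?dy y) (ellD dh h) + r\<^sup>2 * bilin (ellD dh h) (ellD dh h)"
        unfolding cost_linear[OF py h(1)] cost_graph_primitive[OF py] by simp
    qed
    with A show "?A \<and> ?S" by (simp add: ell_eq_ellD)
  }
  {
    assume AS: "?A \<and> ?S"
    have "cost m q T \<alpha> a b c y \<le> cost m q T \<alpha> a b c z"
      if z: "z \<in> W21_graph m T" "admissible m q T y0 z" for z
    proof -
      define h where "h = (\<lambda>j t. z j t + (- 1) * y j t)"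
      define dh where "dh = (\<lambda>j t. graph_deriv T z j t + (- 1) * ?dy j t)"
      have h: "graph_primitive h dh"
        unfolding h_def dh_def by (intro graph_primitive_linear graph_primitive_graph_deriv y z)
      have "admissible m q T 0 h" using AS z(2) by (simp add: admissible_def h_def)
      with AS h have 0: "bilin (ellD ?dy y) (ellD dh h) = 0" by (simp add: ell_eq_ellD)
      have "z = (\<lambda>j t. y j t + 1 * h j t)" by (simp add: h_def)
      then show ?thesis
        using cost_linear[OF py h, of 1] 0 bilin_nonneg[of "ellD dh h"] cost_graph_primitive[OF py] by simp
    qed
    with AS y show ?V by (simp add: variational_solution_def)
  }
qed

section \<open>The first variation and its boundary terms\<close>

lemma bilin_ellD:
  assumes L: "L2_graph L" and h: "graph_primitive h dh" and adm: "admissible m q T 0 h"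
  shows "bilin L (ellD dh h) =
    (\<Sum>j=1..m. intg 0 (l j) (\<lambda>t. flux L j t * dh j t) + intg 0 (l j) (\<lambda>t. source L j t * h j t))"
proof -
  note L2 = graph_primitive_L2[OF h]
  \<comment> \<open>For j >= 2, (E) makes h_j and, a.e., also dh_j vanish beyond l_j, which cuts the
    undelayed terms down to (0, l_j); \<open>adj_delay\<close> delivers the delayed ones on that
    interval.\<close>
  have loc: "intg 0 (T j) (\<lambda>t. L j t * dh j t) = intg 0 (l j) (\<lambda>t. L j t * dh j t)"
    "intg 0 (T j) (\<lambda>t. L j t * h j t) = intg 0 (l j) (\<lambda>t. L j t * h j t)" if j: "j \<in> {1..m}" for j
  proof -
    have len: "0 \<le> l j" "l j \<le> T j" using len_pos[OF j] len_le[OF j] by auto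
    have h0: "h j t = 0" if "j \<noteq> 1" "t \<in> {l j..T j}" for t
      using adm j that by (auto simp: admissible_def)
    have dh0: "AE t in lborel. t \<in> {l j<..<T j} \<longrightarrow> dh j t = 0"
    proof (cases "j = 1")
      case True then show ?thesis by (simp add: len_1)
    next
      case False
      show ?thesis
        by (rule is_primitive_deriv_zero_AE[OF graph_primitiveD[OF h j] h0[OF False]]) (use len in auto)
    qed
    have i: "intgbl 0 (T j) (\<lambda>t. L j t * dh j t)" "intgbl 0 (T j) (\<lambda>t. L j t * h j t)"
      by (intro L2_graph_mult L L2 j)+
    have "intgbl (l j) (T j) (\<lambda>t. L j t * dh j t)"
      by (rule set_integrable_subset[OF i(1)]) (use len in auto)
    then have "intg (l j) (T j) (\<lambda>t. L j t * dh j t) = intg (l j) (T j) (\<lambda>_. 0)"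
      using dh0 by (intro intg_cong_AE) (auto simp: set_integrable_def elim!: eventually_mono)
    moreover have "intg (l j) (T j) (\<lambda>t. L j t * h j t) = intg (l j) (T j) (\<lambda>_. 0)"
    proof (cases "j = 1")
      case False
      show ?thesis by (rule intg_cong) (simp add: h0[OF False])
    qed (simp add: len_1)
    ultimately show "intg 0 (T j) (\<lambda>t. L j t * dh j t) = intg 0 (l j) (\<lambda>t. L j t * dh j t)"
      "intg 0 (T j) (\<lambda>t. L j t * h j t) = intg 0 (l j) (\<lambda>t. L j t * h j t)"
      using intg_split[OF len i(1)] intg_split[OF len i(2)] by simp_all
  qed
  let ?X = "\<lambda>v j. intg 0 (T j) (\<lambda>t. L j t * delay_ext T v j (arg j t))"
  have E: "\<alpha> j * intg 0 (T j) (\<lambda>t. L j t * ellD dh h j t) =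
      \<alpha> j * intg 0 (l j) (\<lambda>t. L j t * dh j t) + \<alpha> j * b j * intg 0 (l j) (\<lambda>t. L j t * h j t)
      + \<alpha> j * a j * ?X dh j + \<alpha> j * c j * ?X h j" if j: "j \<in> {1..m}" for j
  proof -
    have i: "intgbl 0 (T j) (\<lambda>t. L j t * dh j t)" "intgbl 0 (T j) (\<lambda>t. L j t * h j t)"
      "intgbl 0 (T j) (\<lambda>t. L j t * delay_ext T dh j (arg j t))"
      "intgbl 0 (T j) (\<lambda>t. L j t * delay_ext T h j (arg j t))"
      by (intro L2_on_mult_integrable L2_graphD[OF _ j] L2_graph_delay[OF _ j] L L2)+
    have "intg 0 (T j) (\<lambda>t. L j t * ellD dh h j t) = intg 0 (T j) (\<lambda>t. (L j t * dh j t + b j * (L j t * h j t))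
        + (a j * (L j t * delay_ext T dh j (arg j t)) + c j * (L j t * delay_ext T h j (arg j t))))"
      by (rule intg_cong) (simp add: ellD_def algebra_simps)
    also have "\<dots> = (intg 0 (T j) (\<lambda>t. L j t * dh j t) + intg 0 (T j) (\<lambda>t. b j * (L j t * h j t)))
      + (intg 0 (T j) (\<lambda>t. a j * (L j t * delay_ext T dh j (arg j t)))
         + intg 0 (T j) (\<lambda>t. c j * (L j t * delay_ext T h j (arg j t))))"
      by (subst set_integral_add(2)[of lborel "{0<..<T j}"]; (subst set_integral_add(2)[of lborel "{0<..<T j}"])?;
          (intro set_integral_add set_integrable_mult_right i refl)?)+
    finally show ?thesis using loc[OF j] by (simp add: algebra_simps)
  qed
  have F: "intg 0 (l j) (\<lambda>t. flux L j t * dh j t) =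
      \<alpha> j * intg 0 (l j) (\<lambda>t. L j t * dh j t) + intg 0 (l j) (\<lambda>t. adj a L j t * dh j t)"
    and S: "intg 0 (l j) (\<lambda>t. source L j t * h j t) =
      \<alpha> j * b j * intg 0 (l j) (\<lambda>t. L j t * h j t) + intg 0 (l j) (\<lambda>t. adj c L j t * h j t)"
    if j: "j \<in> {1..m}" for j
  proof -
    have i: "intgbl 0 (l j) (\<lambda>t. \<alpha> j * (L j t * dh j t))" "intgbl 0 (l j) (\<lambda>t. adj a L j t * dh j t)"
      "intgbl 0 (l j) (\<lambda>t. \<alpha> j * b j * (L j t * h j t))" "intgbl 0 (l j) (\<lambda>t. adj c L j t * h j t)"
      by (intro set_integrable_mult_right L2_on_mult_integrable L2_on_len[OF _ j] L2_adj[OF _ j] L L2)+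
    show "intg 0 (l j) (\<lambda>t. flux L j t * dh j t) =
      \<alpha> j * intg 0 (l j) (\<lambda>t. L j t * dh j t) + intg 0 (l j) (\<lambda>t. adj a L j t * dh j t)"
      using set_integral_add(2)[OF i(1,2)] by (simp add: flux_def algebra_simps)
    show "intg 0 (l j) (\<lambda>t. source L j t * h j t) =
      \<alpha> j * b j * intg 0 (l j) (\<lambda>t. L j t * h j t) + intg 0 (l j) (\<lambda>t. adj c L j t * h j t)"
      using set_integral_add(2)[OF i(3,4)] by (simp add: source_def algebra_simps)
  qed
  have "bilin L (ellD dh h) = (\<Sum>j=1..m. \<alpha> j * intg 0 (l j) (\<lambda>t. L j t * dh j t))
      + (\<Sum>j=1..m. \<alpha> j * b j * intg 0 (l j) (\<lambda>t. L j t * h j t))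
      + (\<Sum>j=1..m. \<alpha> j * a j * ?X dh j) + (\<Sum>j=1..m. \<alpha> j * c j * ?X h j)"
    unfolding bilin_def sum.distrib[symmetric] by (rule sum.cong) (simp_all only: E)
  also have "\<dots> = (\<Sum>j=1..m. \<alpha> j * intg 0 (l j) (\<lambda>t. L j t * dh j t))
      + (\<Sum>j=1..m. \<alpha> j * b j * intg 0 (l j) (\<lambda>t. L j t * h j t))
      + (\<Sum>j=1..m. intg 0 (l j) (\<lambda>t. adj a L j t * dh j t)) + (\<Sum>j=1..m. intg 0 (l j) (\<lambda>t. adj c L j t * h j t))"
    by (simp only: adj_delay[OF L L2(1)] adj_delay[OF L L2(2)])
  also have "\<dots> = (\<Sum>j=1..m. intg 0 (l j) (\<lambda>t. flux L j t * dh j t) + intg 0 (l j) (\<lambda>t. source L j t * h j t))"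
    unfolding sum.distrib[symmetric] by (rule sum.cong) (simp_all add: F S)
  finally show ?thesis .
qed

text \<open>Among the end-point values only the vertex survives: h_1(0) = 0 by (I), h_j(l_j) = 0 by
  (E) for j >= 2, and (C) turns every h_j(0) into h_1(T_1). \<open>P\<close> stands in for the flux,
  which as an L_2 class has no end-point values.\<close>

lemma bilin_ellD_boundary:
  assumes L: "L2_graph L" and h: "graph_primitive h dh" and adm: "admissible m q T 0 h"
    and P: "\<And>j. j \<in> {1..m} \<Longrightarrow> is_primitive 0 (l j) (P j) (source L j)"
    and P_eq: "\<And>j. j \<in> {1..m} \<Longrightarrow> AE t in lborel. t \<in> {0<..<l j} \<longrightarrow> P j t = flux L j t"
  shows "bilin L (ellD dh h) = (P 1 (T 1) - (\<Sum>j=2..m. P j 0)) * h 1 (T 1)"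
proof -
  note L2 = graph_primitive_L2[OF h]
  have "intg 0 (l j) (\<lambda>t. flux L j t * dh j t) + intg 0 (l j) (\<lambda>t. source L j t * h j t)
      = P j (l j) * h j (l j) - P j 0 * h j 0" if j: "j \<in> {1..m}" for j
  proof -
    have "intg 0 (l j) (\<lambda>t. P j t * dh j t) + intg 0 (l j) (\<lambda>t. source L j t * h j t)
        = P j (l j) * h j (l j) - P j 0 * h j 0"
      using len_pos[OF j]
      by (intro is_primitive_by_parts[OF P[OF j] is_primitive_subinterval[OF graph_primitiveD[OF h j] len_le[OF j]]]) auto
    moreover have "P j \<in> L2_on 0 (l j)" using is_primitive_continuous[OF P[OF j]] by (rule L2_on_continuous)
    then have "intg 0 (l j) (\<lambda>t. P j t * dh j t) = intg 0 (l j) (\<lambda>t. flux L j t * dh j t)"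
      using P_eq[OF j] by (intro intg_cong_AE L2_on_mult_integrable L2_flux[OF L j] L2_on_len[OF L2(1) j])
        (auto elim!: eventually_mono)
    ultimately show ?thesis by simp
  qed
  then have "bilin L (ellD dh h) = (\<Sum>j=1..m. P j (l j) * h j (l j) - P j 0 * h j 0)"
    unfolding bilin_ellD[OF L h adm] by (intro sum.cong) auto
  also have "\<dots> = P 1 (T 1) * h 1 (T 1) + (\<Sum>j=2..m. P j (l j) * h j (l j) - P j 0 * h j 0)"
    unfolding sum_split_1 len_1 using adm by (simp add: admissible_def)
  also have "(\<Sum>j=2..m. P j (l j) * h j (l j) - P j 0 * h j 0) = (\<Sum>j=2..m. - (P j 0 * h 1 (T 1)))"
  proof (rule sum.cong)
    fix j assume j: "j \<in> {2..m}"
    then have "l j \<in> {l j..T j}" using len_le[of j] by auto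
    then have "h j (l j) = 0" "h j 0 = h 1 (T 1)" using adm j by (auto simp: admissible_def)
    then show "P j (l j) * h j (l j) - P j 0 * h j 0 = - (P j 0 * h 1 (T 1))" by simp
  qed simp
  finally show ?thesis by (simp add: sum_negf sum_distrib_right left_diff_distrib)
qed

text \<open>A test function on (0, l_j) vanishes at both ends and beyond l_j, so extending it by
  zero to the other edges respects (I), (C) and (E). For such h the first variation is the defining
  identity of a weak derivative, so regularity of the flux is obtained rather than
  presupposed.\<close>

lemma flux_weak_deriv_of_stationary:
  assumes L: "L2_graph L" and j: "j \<in> {1..m}"
    and stat: "\<And>h dh. graph_primitive h dh \<Longrightarrow> admissible m q T 0 h \<Longrightarrow> bilin L (ellD dh h) = 0"
  shows "is_weak_deriv 0 (l j) (flux L j) (source L j)"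
  unfolding is_weak_deriv_def
proof (intro allI impI)
  fix \<phi> assume \<phi>: "test_function 0 (l j) \<phi>"
  define h where "h k = (if k = j then \<phi> else (\<lambda>_. 0))" for k
  define dh where "dh k = (if k = j then deriv \<phi> else (\<lambda>_. 0))" for k
  have h: "graph_primitive h dh"
    using test_function_is_primitive[OF \<phi>]
    by (auto simp: graph_primitive_def h_def dh_def is_primitive_zero)
  have out: "\<phi> t = 0" if "t \<le> 0 \<or> l j \<le> t" for t
    using test_function_outside[OF \<phi>, of t] that by auto
  have "admissible m q T 0 h"
    using out len_1 by (auto simp: admissible_def h_def)
  from stat[OF h this] bilin_ellD[OF L h this]
  have "(\<Sum>k=1..m. intg 0 (l k) (\<lambda>t. flux L k t * dh k t) + intg 0 (l k) (\<lambda>t. source L k t * h k t)) = 0"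
    by simp
  also have "(\<Sum>k=1..m. intg 0 (l k) (\<lambda>t. flux L k t * dh k t) + intg 0 (l k) (\<lambda>t. source L k t * h k t))
      = (\<Sum>k=1..m. if k = j then intg 0 (l j) (\<lambda>t. flux L j t * deriv \<phi> t) + intg 0 (l j) (\<lambda>t. source L j t * \<phi> t) else 0)"
    by (rule sum.cong) (auto simp: h_def dh_def)
  finally show "intg 0 (l j) (\<lambda>t. flux L j t * deriv \<phi> t) = - intg 0 (l j) (\<lambda>t. source L j t * \<phi> t)"
    using j by (simp add: sum.delta)
qed

lemma flux_balance_of_stationary:
  assumes L: "L2_graph L"
    and stat: "\<And>h dh. graph_primitive h dh \<Longrightarrow> admissible m q T 0 h \<Longrightarrow> bilin L (ellD dh h) = 0"
    and P: "\<And>j. j \<in> {1..m} \<Longrightarrow> is_primitive 0 (l j) (P j) (source L j)"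
    and P_eq: "\<And>j. j \<in> {1..m} \<Longrightarrow> AE t in lborel. t \<in> {0<..<l j} \<longrightarrow> P j t = flux L j t"
  shows "P 1 (T 1) = (\<Sum>j=2..m. P j 0)"
proof -
  \<comment> \<open>A direction with vertex value 1: a ramp on edge 1 and a tent ending at l_k on
    every other edge. The boundary formula then equals the Kirchhoff defect itself.\<close>
  define h where "h k = (if k = 1 then (\<lambda>t. t / T 1) else (\<lambda>t. max 0 (1 - t / l k)))" for k
  define dh where "dh k = (if k = 1 then (\<lambda>_. 1 / T 1) else (\<lambda>t. if t < l k then - 1 / l k else 0))" for k
  have h: "graph_primitive h dh"
    unfolding graph_primitive_def
  proof
    fix j assume j: "j \<in> {1..m}"
    show "is_primitive 0 (T j) (h j) (dh j)"
      using is_primitive_linear[of "T 1" "T 1"] is_primitive_tent[OF len_pos[OF j], of "T j"]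
      by (cases "j = 1") (simp_all add: h_def dh_def)
  qed
  have "0 < l j" if "j \<in> {2..m}" for j using len_pos that by simp
  then have "admissible m q T 0 h"
    using T1_pos by (force simp: admissible_def h_def)
  with h have "bilin L (ellD dh h) = (P 1 (T 1) - (\<Sum>j=2..m. P j 0)) * h 1 (T 1)" "bilin L (ellD dh h) = 0"
    using bilin_ellD_boundary[OF L h _ P P_eq] stat by blast+
  then show ?thesis using T1_pos by (simp add: h_def)
qed

text \<open>Both directions pass through one form of the equation: \<open>source\<close> is a weak
  derivative of \<open>flux\<close>. Then the continuous representatives \<open>P j\<close> are
  primitives of \<open>source\<close>, and the Kirchhoff condition is a relation between their
  end-point values.\<close>

lemma variational_iff_generalized:
  assumes y: "y \<in> W21_graph m T"
  shows "variational_solution m q T \<alpha> a b c y0 y \<longleftrightarrow> generalized_solution m q T \<alpha> a b c y0 y"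
proof -
  define L where "L = ell q T a b c y"
  have L: "L2_graph L"
    using graph_primitive_L2(3)[OF graph_primitive_graph_deriv[OF y]] by (simp add: L_def ell_eq_ellD)
  define P where "P j = cont_rep 0 (l j) (flux L j)" for j
  have kirchhoff_iff: "kirchhoff m q T \<alpha> a b c y \<longleftrightarrow> P 1 (T 1) = (\<Sum>j=2..m. P j 0)"
    by (simp add: kirchhoff_def ell_hat_eq_flux P_def L_def)
  have P: "is_primitive 0 (l j) (P j) (source L j)"
      "AE t in lborel. t \<in> {0<..<l j} \<longrightarrow> P j t = flux L j t"
    if "j \<in> {1..m}" "flux L j \<in> W21_class 0 (l j)" "is_weak_deriv 0 (l j) (flux L j) (source L j)" for j
    unfolding P_def
    using cont_rep_is_primitive[OF that(2) L2_source[OF L that(1)] that(3) len_pos[OF that(1)]] by auto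
  show ?thesis
  proof
    assume "variational_solution m q T \<alpha> a b c y0 y"
    then have adm: "admissible m q T y0 y"
      and stat: "\<And>h dh. graph_primitive h dh \<Longrightarrow> admissible m q T 0 h \<Longrightarrow> bilin L (ellD dh h) = 0"
      by (auto simp: variational_iff_stationary[OF y] L_def)
    have wd: "is_weak_deriv 0 (l j) (flux L j) (source L j)" if "j \<in> {1..m}" for j
      using flux_weak_deriv_of_stationary[OF L that stat] .
    \<comment> \<open>Membership of the flux in W_2^1 is a conclusion here: \<open>source\<close>
      has been found as its weak derivative and is square integrable.\<close>
    have cl: "flux L j \<in> W21_class 0 (l j)" if "j \<in> {1..m}" for j
      using wd[OF that] L2_flux[OF L that] L2_source[OF L that] by (auto simp: W21_class_def)
    have "AE t in lborel. t \<in> {0<..<l j} \<longrightarrow> bvp_operator m q T \<alpha> a b c y j t = 0" if "j \<in> {1..m}" for j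
      using weak_deriv_AE_eq[OF cl[OF that] L2_source[OF L that] wd[OF that]]
      by eventually_elim (auto simp: bvp_operator_eq L_def)
    moreover have "kirchhoff m q T \<alpha> a b c y"
      unfolding kirchhoff_iff
      by (rule flux_balance_of_stationary[OF L stat P]) (auto intro: cl wd)
    ultimately show "generalized_solution m q T \<alpha> a b c y0 y"
      using y adm cl by (auto simp: generalized_solution_def ell_hat_eq_flux L_def)
  next
    assume G: "generalized_solution m q T \<alpha> a b c y0 y"
    have cl: "flux L j \<in> W21_class 0 (l j)" if "j \<in> {1..m}" for j
      using G that by (auto simp: generalized_solution_def ell_hat_eq_flux L_def)
    \<comment> \<open>The equation says that the chosen \<open>weak_deriv\<close> equals
      \<open>source\<close> a.e., so \<open>source\<close> may replace it as a weak
      derivative.\<close>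
    have wd: "is_weak_deriv 0 (l j) (flux L j) (source L j)" if j: "j \<in> {1..m}" for j
    proof (rule is_weak_deriv_cong_AE[OF weak_deriv_W21_class(2)[OF cl[OF j]] _
          weak_deriv_W21_class(1)[OF cl[OF j]] L2_source[OF L j]])
      have "AE t in lborel. t \<in> {0<..<l j} \<longrightarrow> bvp_operator m q T \<alpha> a b c y j t = 0"
        using G j by (auto simp: generalized_solution_def)
      then show "AE t in lborel. t \<in> {0<..<l j} \<longrightarrow> weak_deriv 0 (l j) (flux L j) t = source L j t"
        by eventually_elim (auto simp: bvp_operator_eq L_def)
    qed
    have K: "P 1 (T 1) = (\<Sum>j=2..m. P j 0)"
      using G by (simp add: generalized_solution_def kirchhoff_iff)
    have "bilin L (ellD dh h) = 0" if h: "graph_primitive h dh" "admissible m q T 0 h" for h dh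
      using bilin_ellD_boundary[OF L h P] cl wd K by simp
    with G show "variational_solution m q T \<alpha> a b c y0 y"
      unfolding variational_iff_stationary[OF y] by (simp add: generalized_solution_def L_def)
  qed
qed

end

theorem mainTheorem1:
  fixes m :: nat and q y0 :: real and T a b c \<alpha> :: "nat \<Rightarrow> real"
    and y :: "nat \<Rightarrow> real \<Rightarrow> real"
  assumes "m \<ge> 2" and "q > 1" and "T 1 > 0"
    and "\<And>j. j \<in> {2..m} \<Longrightarrow> T j > (q - 1) * T 1"
    and "\<And>j. j \<in> {1..m} \<Longrightarrow> \<alpha> j > 0"
    and "y \<in> W21_graph m T"
  shows "variational_solution m q T \<alpha> a b c y0 y \<longleftrightarrow> generalized_solution m q T \<alpha> a b c y0 y"
proof -
  interpret star_graph m q T \<alpha> a b c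
    using assms(1-5) by unfold_locales
  show ?thesis using assms(6) by (rule variational_iff_generalized)
qed

end
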